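(* Let $A\in\mathbb{R}_{\max}^{n\times n}$ with $\lambda(A)\ne-\infty$, and let $B_{\mathrm{CT}}$ be the matrix of the cycle threshold scheme. With $\mathrm{cr}=\mathrm{cr}(\mathcal D(A))$ and $\mathrm{cd}=\mathrm{cd}(\mathcal D(A))$, all of the following bounds hold: $$T_1(A,B_{\mathrm{CT}})\le \mathrm{Wi}(n),$$ $$T_1(A,B_{\mathrm{CT}})\le (n-1)\,\mathrm{cr}+\min(n,\ \mathrm{cd}+\mathrm{cr}+1),$$ $$T_1(A,B_{\mathrm{CT}})\le (\mathrm{cd}+\mathrm{cr}-1)\,\mathrm{cr}+\mathrm{cd}+1.$$
   Context: Max-plus conventions: $\mathbb{R}_{\max}=\mathbb{R}\cup\{-\infty\}$ with $a\oplus b=\max(a,b)$, $a\otimes b=a+b$; matrix sums, products and powers are max-plus ($A^0=I$ has $0$ on the diagonal and $-\infty$ elsewhere). $\mathcal D(A)$ is the digraph with nodes $1,\dots,n$ and an edge $(i,j)$ of weight $a_{ij}$ whenever $a_{ij}\ne-\infty$. A walk $W$ has length $l(W)$ (number of edges) and weight $p(W)$ (sum of edge weights). A path has no repeated node; a cycle is a closed walk of positive length with no repeated node except start $=$ end. $\lambda(A)$ is the maximum of $p(Z)/l(Z)$ over cycles $Z$ ($-\infty$ if there is none). The critical graph $\mathcal G^c(A)$ consists of the nodes and edges lying on cycles of mean $\lambda(A)$. s.c.c. = strongly connected component. The cyclicity of a strongly connected digraph is the gcd of the lengths of its closed walks; of a general digraph it is the lcm of the cyclicities of its s.c.c.'s.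 CSR terms (with respect to $\mathcal G=\mathcal G^c(A)$): let $\gamma$ be the cyclicity of $\mathcal G$, $\bar A$ the matrix with entries $a_{ij}-\lambda(A)$, $M=(\bar A^{\gamma})^*$ with $X^*=\bigoplus_{k\ge0}X^k$. Then $c_{ij}=m_{ij}$ if $j$ is a node of $\mathcal G$, else $-\infty$; $r_{ij}=m_{ij}$ if $i$ is a node of $\mathcal G$, else $-\infty$; $s_{ij}=\bar a_{ij}$ if $(i,j)$ is an edge of $\mathcal G$, else $-\infty$. $T_1(A,B)$ is the smallest integer $T\ge0$ such that $A^t=\big(t\lambda(A)\otimes CS^tR\big)\oplus B^t$ for all integers $t\ge T$. Cycle threshold scheme: for $\mu\in\mathbb{R}$ let $\mathcal T^{ct}(\mu)$ be the subgraph of $\mathcal D(A)$ consisting of all nodes and edges of cycles of mean weight $\ge\mu$. Let $\mu^{ct}$ be the largest $\mu\le\lambda(A)$ such that $\mathcal T^{ct}(\mu)$ has an s.c.c. containing no s.c.c. of $\mathcal G^c(A)$; if there is none, $\mu^{ct}=-\infty$ and $\mathcal T^{ct}(\mu^{ct})=\mathcal D(A)$. Let $\mathcal G^{ct}$ be the union of the s.c.c.'s of $\mathcal T^{ct}(\mu^{ct})$ intersecting $\mathcal G^c(A)$. $B_{\mathrm{CT}}=(b_{ij})$ with $b_{ij}=-\infty$ if $i$ or $j$ is a node of $\mathcal G^{ct}$, and $b_{ij}=a_{ij}$ otherwise. Parameters: $\mathrm{Wi}(1)=0$, $\mathrm{Wi}(n)=(n-1)^2+1$ for $n>1$; $\mathrm{cr}$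 = greatest length of a cycle; $\mathrm{cd}$ = greatest length of a path. *)

theory Defs
  imports
    Complex_Main
    "HOL-Library.Cardinality"
    "HOL-Library.Extended_Nat"
    "HOL-Library.Extended_Real"
    "Graph_Theory.Graph_Theory"
begin

section \<open>Max-plus matrices\<close>

text \<open>
  An \<open>n \<times> n\<close> max-plus matrix is a function on a finite index type of cardinality \<open>n\<close>.
  Entries are taken from \<^typ>\<open>ereal\<close>; membership in
  \<open>\<real> \<union> {-\<infinity>}\<close> is the predicate \<open>max_plus_matrix\<close>.
\<close>

type_synonym 'n mp_matrix = "'n \<Rightarrow> 'n \<Rightarrow> ereal"

definition max_plus_matrix :: "'n mp_matrix \<Rightarrow> bool" where
  "max_plus_matrix A \<longleftrightarrow> (\<forall>i j. A i j \<noteq> \<infinity>)"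

definition mp_add :: "'n mp_matrix \<Rightarrow> 'n mp_matrix \<Rightarrow> 'n mp_matrix" where
  "mp_add A B = (\<lambda>i j. max (A i j) (B i j))"

definition mp_mult :: "'n::finite mp_matrix \<Rightarrow> 'n mp_matrix \<Rightarrow> 'n mp_matrix" where
  "mp_mult A B = (\<lambda>i j. Max (range (\<lambda>k. A i k + B k j)))"

definition mp_scale :: "ereal \<Rightarrow> 'n mp_matrix \<Rightarrow> 'n mp_matrix" where
  "mp_scale c A = (\<lambda>i j. c + A i j)"

definition mp_one :: "'n mp_matrix" where
  "mp_one = (\<lambda>i j. if i = j then 0 else -\<infinity>)"

primrec mp_power :: "'n::finite mp_matrix \<Rightarrow> nat \<Rightarrow> 'n mp_matrix" where
  "mp_power A 0 = mp_one"
| "mp_power A (Suc t) = mp_mult A (mp_power A t)"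

definition mp_star :: "'n::finite mp_matrix \<Rightarrow> 'n mp_matrix" where
  "mp_star X = (\<lambda>i j. SUP k. mp_power X k i j)"


section \<open>Digraphs, cycle means and cyclicity\<close>

type_synonym 'n dgraph = "('n, 'n \<times> 'n) pre_digraph"

definition mp_digraph :: "'n mp_matrix \<Rightarrow> 'n dgraph" where
  "mp_digraph A =
    \<lparr>verts = UNIV, arcs = {(i, j). A i j \<noteq> -\<infinity>}, tail = fst, head = snd\<rparr>"

text \<open>
  Walks are lists of arcs. On arcs of \<open>mp_digraph A\<close> the entries of a max-plus matrix are
  finite, so \<^const>\<open>real_of_ereal\<close> loses nothing.
\<close>

definition weight :: "'n mp_matrix \<Rightarrow> ('n \<times> 'n) list \<Rightarrow> real" where
  "weight A W = (\<Sum>e\<leftarrow>W. real_of_ereal (A (fst e) (snd e)))"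

definition mean :: "'n mp_matrix \<Rightarrow> ('n \<times> 'n) list \<Rightarrow> real" where
  "mean A Z = weight A Z / real (length Z)"

definition mp_cycle :: "'n mp_matrix \<Rightarrow> ('n \<times> 'n) list \<Rightarrow> bool" where
  "mp_cycle A Z \<longleftrightarrow> pre_digraph.cycle (mp_digraph A) Z"

definition max_cycle_mean :: "'n mp_matrix \<Rightarrow> ereal" where
  "max_cycle_mean A =
    (if \<exists>Z. mp_cycle A Z then ereal (Max {mean A Z | Z. mp_cycle A Z}) else -\<infinity>)"

definition cycles_subgraph :: "'n mp_matrix \<Rightarrow> (('n \<times> 'n) list \<Rightarrow> bool) \<Rightarrow> 'n dgraph" where
  "cycles_subgraph A P =
    \<lparr>verts = {i. \<exists>Z. mp_cycle A Z \<and> P Z \<and> i \<in> fst ` set Z \<union> snd ` set Z},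
     arcs = {e. \<exists>Z. mp_cycle A Z \<and> P Z \<and> e \<in> set Z},
     tail = fst, head = snd\<rparr>"

definition critical_graph :: "'n mp_matrix \<Rightarrow> 'n dgraph" where
  "critical_graph A = cycles_subgraph A (\<lambda>Z. ereal (mean A Z) = max_cycle_mean A)"

definition scc_cyclicity :: "'n dgraph \<Rightarrow> nat" where
  "scc_cyclicity H = Gcd {length W | W. \<exists>u. pre_digraph.awalk H u W u}"

definition cyclicity :: "'n dgraph \<Rightarrow> nat" where
  "cyclicity G = Lcm (scc_cyclicity ` pre_digraph.sccs G)"

definition cr :: "'n dgraph \<Rightarrow> nat" where
  "cr G = Max {length Z | Z. pre_digraph.cycle G Z}"

definition cd :: "'n dgraph \<Rightarrow> nat" where
  "cd G = Max {length W | W. \<exists>u v. pre_digraph.apath G u W v}"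


section \<open>CSR terms\<close>

definition normalized :: "'n mp_matrix \<Rightarrow> 'n mp_matrix" where
  "normalized A = (\<lambda>i j. A i j - max_cycle_mean A)"

definition csr_M :: "'n::finite mp_matrix \<Rightarrow> 'n mp_matrix" where
  "csr_M A = mp_star (mp_power (normalized A) (cyclicity (critical_graph A)))"

definition csr_C :: "'n::finite mp_matrix \<Rightarrow> 'n mp_matrix" where
  "csr_C A = (\<lambda>i j. if j \<in> verts (critical_graph A) then csr_M A i j else -\<infinity>)"

definition csr_R :: "'n::finite mp_matrix \<Rightarrow> 'n mp_matrix" where
  "csr_R A = (\<lambda>i j. if i \<in> verts (critical_graph A) then csr_M A i j else -\<infinity>)"

definition csr_S :: "'n mp_matrix \<Rightarrow> 'n mp_matrix" where
  "csr_S A = (\<lambda>i j. if (i, j) \<in> arcs (critical_graph A) then normalized A i j else -\<infinity>)"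

definition csr :: "'n::finite mp_matrix \<Rightarrow> nat \<Rightarrow> 'n mp_matrix" where
  "csr A t = mp_mult (mp_mult (csr_C A) (mp_power (csr_S A) t)) (csr_R A)"

text \<open>
  The threshold is an \<^typ>\<open>enat\<close>, with value \<open>\<infinity>\<close> (the infimum of the empty set) if no
  suitable \<open>T\<close> exists. Thus a finite upper bound includes the existence of such a \<open>T\<close>.
\<close>

definition T1 :: "'n::finite mp_matrix \<Rightarrow> 'n mp_matrix \<Rightarrow> enat" where
  "T1 A B = Inf (enat ` {T. \<forall>t\<ge>T. mp_power A t =
      mp_add (mp_scale (ereal (real t) * max_cycle_mean A) (csr A t)) (mp_power B t)})"


section \<open>The cycle threshold scheme\<close>

definition ct_subgraph :: "'n mp_matrix \<Rightarrow> ereal \<Rightarrow> 'n dgraph" where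
  "ct_subgraph A \<mu> =
    (if \<mu> = -\<infinity> then mp_digraph A else cycles_subgraph A (\<lambda>Z. ereal (mean A Z) \<ge> \<mu>))"

definition ct_admissible :: "'n mp_matrix \<Rightarrow> real \<Rightarrow> bool" where
  "ct_admissible A \<mu> \<longleftrightarrow> ereal \<mu> \<le> max_cycle_mean A \<and>
    (\<exists>H \<in> pre_digraph.sccs (ct_subgraph A (ereal \<mu>)).
      \<not> (\<exists>K \<in> pre_digraph.sccs (critical_graph A). subgraph K H))"

text \<open>
  Since there are finitely many cycles, the admissible \<open>\<mu>\<close> have a greatest element as soon as
  there is one.
\<close>

definition mu_ct :: "'n mp_matrix \<Rightarrow> ereal" where
  "mu_ct A = (if \<exists>\<mu>. ct_admissible A \<mu> then ereal (GREATEST \<mu>. ct_admissible A \<mu>) else -\<infinity>)"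

definition G_ct :: "'n mp_matrix \<Rightarrow> 'n dgraph" where
  "G_ct A = pre_digraph.Union (mp_digraph A)
    {H \<in> pre_digraph.sccs (ct_subgraph A (mu_ct A)). verts H \<inter> verts (critical_graph A) \<noteq> {}}"

definition B_CT :: "'n mp_matrix \<Rightarrow> 'n mp_matrix" where
  "B_CT A = (\<lambda>i j. if i \<in> verts (G_ct A) \<or> j \<in> verts (G_ct A) then -\<infinity> else A i j)"


definition Wi :: "nat \<Rightarrow> nat" where
  "Wi n = (if n = 1 then 0 else (n - 1)\<^sup>2 + 1)"

end

(* Power entries of A are maximal walk weights, and t lambda + C S^t R collects the walks that
   visit a critical node and whose length is congruent to t modulo the cyclicity, without any
   bound on the length.

   Cycle removal: if every path in a walk has at most q arcs, then each block of q + 1 consecutive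
   arcs contains a cycle. Among c such cycles, some nonempty subfamily has total length divisible by
   c, and it can be cut out.

   C S^t R <= A^t: take c to be the length of a critical cycle Z met by the walk. Cut out cycles, which
   does not decrease the weight after normalisation, until the walk is shorter than T + c, then fill
   up to length t with copies of Z. When Z is Hamiltonian, a minimal family of arcs is reconnected
   along Z instead.

   A^t <= C S^t R or B^t: suppose no heaviest walk of length t meets a critical node, although one
   meets G^ct. Choose mu maximal such that some heaviest walk meets a node that is joined to the
   critical graph by a chain of cycles of mean at least mu. By the choice of mu^ct, all cycles in
   heaviest walks then have mean at most mu, so cut-out cycles can be exchanged for the next cycle of
   the chain, and heaviest walks advance along the chain to a critical node. *)
theory Submission
  imports Defs "HOL-Number_Theory.Cong" "HOL-Library.Multiset"
begin

section \<open>Walks and cycle removal\<close>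

text \<open>Two moduli have to be reconciled: the CSR term fixes lengths only modulo
  \<open>gamma\<close>, while cutting and refilling with one critical cycle \<open>Z\<close> works
  modulo \<open>length Z\<close>. The bridge is that closed critical walks through a node realise,
  modulo \<open>length Z\<close>, every multiple of \<open>gamma\<close>. A node of \<open>Z\<close>
  must also survive the cutting, so that copies of \<open>Z\<close> can still be inserted. The walk
  is therefore split at such a node and both pieces are cut separately. With cycle length
  \<open>c\<close> and path bound \<open>q\<close> this leaves at most
  \<open>(c - 1) * (q + 1) + 2 * q\<close> arcs. The upper inequality gains from walks that avoid
  the critical nodes, whose paths have at most \<open>n - 2\<close> arcs; \<open>Wi\<close> needs in
  addition that up to the first node on the cycle only nodes off the cycle are available. For a
  Hamiltonian cycle these savings do not suffice. In the lower inequality that case is settled by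
  zero-sum arguments modulo \<open>n\<close>; in the upper one the count fails only if the walk
  misses a single node, which then carries a critical loop.\<close>

fun walk :: "'a \<Rightarrow> ('a \<times> 'a) list \<Rightarrow> 'a \<Rightarrow> bool" where
  "walk u [] v \<longleftrightarrow> u = v"
| "walk u (e # p) v \<longleftrightarrow> fst e = u \<and> walk (snd e) p v"

text \<open>Only heads are required to be distinct, because the start node reappears as the last
  head.\<close>

definition is_cyc :: "('a \<times> 'a) list \<Rightarrow> bool" where
  "is_cyc z \<longleftrightarrow> z \<noteq> [] \<and> distinct (map snd z) \<and> (\<exists>w. walk w z w)"

lemma walk_append: "walk u (p @ q) v \<longleftrightarrow> (\<exists>w. walk u p w \<and> walk w q v)"
  by (induction p arbitrary: u) auto

lemma walk_appendI: "walk u p w \<Longrightarrow> walk w q v \<Longrightarrow> walk u (p @ q) v"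
  by (auto simp: walk_append)

lemma walk_last: "walk u p v \<Longrightarrow> p \<noteq> [] \<Longrightarrow> snd (last p) = v"
  by (induction p arbitrary: u) (auto split: if_splits)

lemma walk_hd: "walk u p v \<Longrightarrow> p \<noteq> [] \<Longrightarrow> fst (hd p) = u"
  by (cases p) auto

lemma walk_unique_end: "walk u p v \<Longrightarrow> walk u p w \<Longrightarrow> v = w"
  by (induction p arbitrary: u) auto

lemma walk_split_node:
  assumes "walk u p v" "k \<in> insert u (snd ` set p)"
  obtains p1 p2 where "p = p1 @ p2" "walk u p1 k" "walk k p2 v"
proof -
  have "\<exists>p1 p2. p = p1 @ p2 \<and> walk u p1 k \<and> walk k p2 v"
  proof (cases "k = u")
    case True
    then show ?thesis using assms by (intro exI[of _ "[]"] exI[of _ p]) auto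
  next
    case False
    then obtain e where e: "e \<in> set p" "k = snd e" using assms by auto
    then obtain a b where ab: "p = a @ e # b" by (meson split_list)
    then have "walk u (a @ [e]) k" "walk k b v"
      using assms(1) e by (auto simp: walk_append)
    then show ?thesis using ab by (intro exI[of _ "a @ [e]"] exI[of _ b]) auto
  qed
  then show thesis using that by blast
qed

lemma walk_tails:
  assumes "walk u p v"
  shows "insert v (fst ` set p) = insert u (snd ` set p)"
  using assms by (induction p arbitrary: u) auto

text \<open>A nonempty \<open>p1\<close> makes the closed part \<open>p2\<close> strictly shorter
  than \<open>p\<close>, which the induction that searches for a cycle relies on.\<close>

lemma walk_tail_split:
  assumes "walk u p v" "\<not> distinct (map snd p)"
  obtains p1 p2 p3 k where "p = p1 @ p2 @ p3" "p1 \<noteq> []" "p2 \<noteq> []" "walk u p1 k" "walk k p2 k" "walk k p3 v"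
proof -
  obtain xs ys zs y where "map snd p = xs @ [y] @ ys @ [y] @ zs"
    using assms(2) not_distinct_decomp by blast
  then have "map snd p = (xs @ [y]) @ (ys @ [y]) @ zs" by simp
  then obtain p1 p' where 1: "p = p1 @ p'" "map snd p1 = xs @ [y]" "map snd p' = (ys @ [y]) @ zs"
    by (metis map_eq_append_conv)
  then obtain p2 p3 where 2: "p' = p2 @ p3" "map snd p2 = ys @ [y]" by (metis map_eq_append_conv)
  have ne: "p1 \<noteq> []" "p2 \<noteq> []" using 1 2 by auto
  have l: "snd (last p1) = y" "snd (last p2) = y"
    using last_map[OF ne(1), of snd] last_map[OF ne(2), of snd] 1(2) 2(2) by auto
  have "walk u (p1 @ p2 @ p3) v" using assms(1) 1 2 by simp
  then obtain k k' where kl: "walk u p1 k" "walk k p2 k'" "walk k' p3 v"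
    by (auto simp: walk_append)
  then have "k = y" "k' = y" using ne l walk_last by fast+
  then show thesis using that[of p1 p2 p3 y] 1 2 ne kl by auto
qed

text \<open>As long as some head occurs twice, descend into a proper closed subwalk. If all heads
  are distinct, only the start can recur, and the prefix up to its return is a cycle.\<close>

lemma walk_contains_cycle:
  assumes "walk u p v" "\<not> distinct (u # map snd p)"
  shows "\<exists>q z s w. p = q @ z @ s \<and> walk u q w \<and> walk w z w \<and> walk w s v \<and> is_cyc z"
  using assms
proof (induction "length p" arbitrary: u p v rule: less_induct)
  case less
  have sub: ?case if "p = a @ b @ c" "walk u a k" "walk k b k" "walk k c v" "b \<noteq> []"
    "length b < length p" for a b c k
  proof -
    have "\<not> distinct (k # map snd b)"
      using walk_last[OF that(3,5)] that(5) by (force simp: image_iff)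
    from less.hyps[OF that(6,3) this]
    obtain q z s w where "b = q @ z @ s" "walk k q w" "walk w z w" "walk w s k" "is_cyc z" by blast
    then show ?thesis using that
      by (intro exI[of _ "a @ q"] exI[of _ z] exI[of _ "s @ c"] exI[of _ w]) (auto simp: walk_append)
  qed
  show ?case
  proof (cases "distinct (map snd p)")
    case False
    then obtain p1 p2 p3 k where "p = p1 @ p2 @ p3" "p1 \<noteq> []" "p2 \<noteq> []" "walk u p1 k" "walk k p2 k" "walk k p3 v"
      using walk_tail_split[OF less.prems(1)] by metis
    then show ?thesis by (intro sub[of p1 p2 p3 k]) auto
  next
    case True
    then have "u \<in> snd ` set p" using less.prems by auto
    then obtain e where e: "e \<in> set p" "u = snd e" by auto
    then obtain a b where ab: "p = (a @ [e]) @ b" by (metis split_list append.assoc append_Cons append_Nil)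
    then have w: "walk u (a @ [e]) u" "walk u b v"
      using less.prems(1) e by (auto simp: walk_append)
    have "is_cyc (a @ [e])" using True w ab by (auto simp: is_cyc_def)
    then show ?thesis using w ab by (intro exI[of _ "[]"] exI[of _ "a @ [e]"] exI[of _ b] exI[of _ u]) auto
  qed
qed

lemma path_decomposition:
  "walk u p v \<Longrightarrow> \<exists>r zs. walk u r v \<and> distinct (u # map snd r) \<and> (\<forall>z\<in>set zs. is_cyc z) \<and>
    mset p = mset r + mset (concat zs)"
proof (induction "length p" arbitrary: p rule: less_induct)
  case less
  show ?case
  proof (cases "distinct (u # map snd p)")
    case True
    then show ?thesis using less.prems by (intro exI[of _ p] exI[of _ "[]"]) auto
  next
    case False
    from walk_contains_cycle[OF less.prems this]
    obtain q z s x where d: "p = q @ z @ s" "walk u q x" "walk x z x" "walk x s v" "is_cyc z" by blast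
    have "length (q @ s) < length p" using d by (simp add: is_cyc_def)
    from less.hyps[OF this walk_appendI[OF d(2,4)]]
    obtain r zs where "walk u r v" "distinct (u # map snd r)" "\<forall>z\<in>set zs. is_cyc z"
      "mset (q @ s) = mset r + mset (concat zs)" by blast
    then show ?thesis using d(1,5) by (intro exI[of _ r] exI[of _ "z # zs"]) (auto simp: ac_simps)
  qed
qed

text \<open>The cycles lie in successive segments of \<open>p\<close>, so each can be cut out
  independently of the others; hence the quantification over all index sets \<open>I\<close>. A
  segment of \<open>q + 1\<close> arcs is too long to be a path, and the search restarts right after
  the cycle found, so every cycle uses up at most \<open>q + 1\<close> arcs and a rest of at most
  \<open>q\<close> arcs remains.\<close>

lemma disjoint_cycles:
  assumes "walk u p v"
    and "\<And>x r y. walk x r y \<Longrightarrow> distinct (x # map snd r) \<Longrightarrow> set r \<subseteq> set p \<Longrightarrow> length r \<le> q"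
  shows "\<exists>zs. (\<forall>z\<in>set zs. is_cyc z) \<and> length p \<le> length zs * (q + 1) + q \<and>
    (\<forall>I. \<exists>p'. walk u p' v \<and> mset p = mset p' + mset (concat (nths zs I)))"
  using assms
proof (induction "length p" arbitrary: u p rule: less_induct)
  case less
  show ?case
  proof (cases "length p \<le> q")
    case True
    then show ?thesis using less.prems(1) by (intro exI[of _ "[]"]) auto
  next
    case False
    define p0 where "p0 = take (q + 1) p"
    have l0: "length p0 = q + 1" using False by (simp add: p0_def)
    have "walk u (p0 @ drop (q + 1) p) v" using less.prems(1) by (simp add: p0_def)
    then obtain k where k: "walk u p0 k" "walk k (drop (q + 1) p) v" by (auto simp: walk_append)
    have "\<not> distinct (u # map snd p0)"
      using less.prems(2)[OF k(1)] l0 set_take_subset[of "q + 1" p] by (auto simp: p0_def)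
    from walk_contains_cycle[OF k(1) this]
    obtain a z s w where d: "p0 = a @ z @ s" "walk u a w" "walk w z w" "walk w s k" "is_cyc z" by blast
    define s' where "s' = s @ drop (q + 1) p"
    have ws': "walk w s' v" using d k by (auto simp: s'_def walk_append)
    have p: "p = a @ z @ s'" using d(1) append_take_drop_id[of "q + 1" p] by (simp add: p0_def s'_def)
    have lens: "length a + length z \<le> q + 1" using l0 d(1) by simp
    have zne: "z \<noteq> []" using d(5) by (simp add: is_cyc_def)
    have "length s' < length p" using p zne by simp
    from less.hyps[OF this ws'] less.prems(2)
    obtain zs where zs: "\<forall>z\<in>set zs. is_cyc z" "length s' \<le> length zs * (q + 1) + q"
      "\<And>I. \<exists>p'. walk w p' v \<and> mset s' = mset p' + mset (concat (nths zs I))"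
      using p by (auto simp: subset_iff)
    have "\<exists>p'. walk u p' v \<and> mset p = mset p' + mset (concat (nths (z # zs) I))" for I
    proof -
      obtain p' where p': "walk w p' v" "mset s' = mset p' + mset (concat (nths zs {j. Suc j \<in> I}))"
        using zs(3) by blast
      show ?thesis
      proof (cases "0 \<in> I")
        case True
        then show ?thesis using p' p d
          by (intro exI[of _ "a @ p'"]) (auto simp: nths_Cons walk_append)
      next
        case False
        then show ?thesis using p' p d
          by (intro exI[of _ "a @ z @ p'"]) (auto simp: nths_Cons walk_append)
      qed
    qed
    then show ?thesis using zs d(5) lens p by (intro exI[of _ "z # zs"]) auto
  qed
qed

section \<open>Families of cycles whose total length is divisible by a given number\<close>

lemma pigeonhole_mod:
  fixes f :: "nat \<Rightarrow> int"
  assumes "0 < c"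
  obtains i j where "i < j" "j \<le> c" "[f i = f j] (mod int c)"
proof -
  have "card ((\<lambda>i. f i mod int c) ` {..c}) \<le> card {0..<int c}"
    using assms by (intro card_mono) auto
  then have "card ((\<lambda>i. f i mod int c) ` {..c}) < card {..c}" by simp
  from pigeonhole[OF this] obtain i j where "i \<in> {..c}" "j \<in> {..c}" "i \<noteq> j" "f i mod int c = f j mod int c"
    by (auto simp: inj_on_def)
  then show thesis using that[of i j] that[of j i] by (cases "i < j") (auto simp: cong_def)
qed

lemma nths_segment: "i \<le> j \<Longrightarrow> take j xs = take i xs @ nths xs {i..<j}"
proof (induction xs arbitrary: i j)
  case (Cons x xs)
  show ?case
  proof (cases i)
    case 0
    have "nths (x # xs) {0..<j} = take j (x # xs)"
      by (simp add: atLeast0LessThan)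
    then show ?thesis using 0 by simp
  next
    case (Suc i')
    then obtain j' where j: "j = Suc j'" using Cons.prems by (cases j) auto
    have "{l. Suc l \<in> {i..<j}} = {i'..<j'}" using Suc j by auto
    then show ?thesis using Suc j Cons by (auto simp: nths_Cons)
  qed
qed auto

text \<open>Among the \<open>c + 1\<close> total lengths of prefixes of \<open>zs\<close> two agree
  modulo \<open>c\<close>; the cycles between them form the subfamily.\<close>

lemma subfamily_length_dvd:
  assumes "0 < c" "c \<le> length zs"
  obtains I where "nths zs I \<noteq> []" "c dvd length (concat (nths zs I))"
proof -
  obtain i j where ij: "i < j" "j \<le> c"
    "[int (length (concat (take i zs))) = int (length (concat (take j zs)))] (mod int c)"
    using pigeonhole_mod[OF assms(1), of "\<lambda>i. int (length (concat (take i zs)))"] by blast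
  have t: "take j zs = take i zs @ nths zs {i..<j}" using ij by (intro nths_segment) auto
  then have "int c dvd int (length (concat (nths zs {i..<j})))"
    using ij(3) by (simp add: cong_iff_dvd_diff dvd_diff_commute) 
  moreover have "nths zs {i..<j} \<noteq> []" using t ij assms(2)
    by (metis append_Nil2 length_take min.absorb2 nat_less_le order_trans)
  ultimately show thesis using that by (meson int_dvd_int_iff)
qed

text \<open>Cutting the two pieces separately keeps the node \<open>k\<close>. The pieces may leave
  rests of \<open>q1\<close> and \<open>q2\<close> arcs, and every cycle uses up at most
  \<open>q2 + 1\<close> arcs, so the bound \<open>long\<close> forces at least \<open>c\<close>
  cycles in total.\<close>

lemma cycle_exchange:
  assumes "walk i p1 k" "walk k p2 j" "0 < c"
    and b1: "\<And>x r y. walk x r y \<Longrightarrow> distinct (x # map snd r) \<Longrightarrow> set r \<subseteq> set p1 \<Longrightarrow> length r \<le> q1"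
    and b2: "\<And>x r y. walk x r y \<Longrightarrow> distinct (x # map snd r) \<Longrightarrow> set r \<subseteq> set p2 \<Longrightarrow> length r \<le> q2"
    and "q1 \<le> q2"
    and long: "(c - 1) * (q2 + 1) + q1 + q2 < length p1 + length p2"
  obtains p1' p2' zs where "walk i p1' k" "walk k p2' j" "zs \<noteq> []" "\<forall>z\<in>set zs. is_cyc z"
    "c dvd length (concat zs)" "mset (p1 @ p2) = mset (p1' @ p2' @ concat zs)"
proof -
  obtain zs1 where z1: "\<forall>z\<in>set zs1. is_cyc z" "length p1 \<le> length zs1 * (q1 + 1) + q1"
    "\<And>I. \<exists>p'. walk i p' k \<and> mset p1 = mset p' + mset (concat (nths zs1 I))"
    using disjoint_cycles[OF assms(1), of q1] b1 by blast
  obtain zs2 where z2: "\<forall>z\<in>set zs2. is_cyc z" "length p2 \<le> length zs2 * (q2 + 1) + q2"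
    "\<And>I. \<exists>p'. walk k p' j \<and> mset p2 = mset p' + mset (concat (nths zs2 I))"
    using disjoint_cycles[OF assms(2), of q2] b2 by blast
  have "length zs1 * (q1 + 1) \<le> length zs1 * (q2 + 1)" using assms(6) by simp
  then have "(c - 1) * (q2 + 1) < (length zs1 + length zs2) * (q2 + 1)"
    unfolding add_mult_distrib using long z1(2) z2(2) by linarith
  then have "c - 1 < length zs1 + length zs2" by (simp only: mult_less_cancel2)
  then have "c \<le> length (zs1 @ zs2)" by simp
  then obtain I where I: "nths (zs1 @ zs2) I \<noteq> []" "c dvd length (concat (nths (zs1 @ zs2) I))"
    using subfamily_length_dvd[OF assms(3)] by metis
  obtain p1' where p1': "walk i p1' k" "mset p1 = mset p1' + mset (concat (nths zs1 I))"
    using z1(3) by blast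
  obtain p2' where p2': "walk k p2' j"
      "mset p2 = mset p2' + mset (concat (nths zs2 {j. j + length zs1 \<in> I}))"
    using z2(3) by blast
  have "\<forall>z\<in>set (nths (zs1 @ zs2) I). is_cyc z"
    using z1(1) z2(1) set_nths_subset[of "zs1 @ zs2" I] by auto
  moreover have "mset (p1 @ p2) = mset (p1' @ p2' @ concat (nths (zs1 @ zs2) I))"
    using p1' p2' by (simp add: nths_append ac_simps)
  ultimately show thesis using that[OF p1'(1) p2'(1) I(1) _ I(2)] by blast
qed

lemma path_length_less_card:
  assumes "walk x r y" "distinct (x # map snd r)" "r \<noteq> [] \<Longrightarrow> fst ` set r \<union> snd ` set r \<subseteq> X"
    "finite X" 
  shows "length r \<le> card X - 1"
proof (cases "r = []")
  case False
  have "set (x # map snd r) \<subseteq> X" using assms(3)[OF False] walk_hd[OF assms(1) False] False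
    hd_in_set[OF False] by (auto simp: image_subset_iff)
  then have "card (set (x # map snd r)) \<le> card X" using assms(4) card_mono by blast
  then show ?thesis using distinct_card[OF assms(2)] by simp
qed simp

section \<open>Weight bounds by cutting out cycles of nonpositive weight\<close>

lemma closed_walk_weight_le_0:
  fixes w :: "'a \<times> 'a \<Rightarrow> real"
  assumes "walk u p u" "set p \<subseteq> E"
    and "\<And>z. is_cyc z \<Longrightarrow> set z \<subseteq> E \<Longrightarrow> sum_list (map w z) \<le> 0"
  shows "sum_list (map w p) \<le> 0"
  using assms(1,2)
proof (induction "length p" arbitrary: p rule: less_induct)
  case less
  show ?case
  proof (cases "p = []")
    case False
    then have "\<not> distinct (u # map snd p)"
      using walk_last[OF less.prems(1) False] by (force simp: image_iff)
    from walk_contains_cycle[OF less.prems(1) this]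
    obtain q z s x where d: "p = q @ z @ s" "walk u q x" "walk x z x" "walk x s u" "is_cyc z" by blast
    have "sum_list (map w (q @ s)) \<le> 0"
      using d less.prems(2) by (intro less.hyps) (auto simp: walk_append is_cyc_def)
    moreover have "sum_list (map w z) \<le> 0" using d less.prems by (intro assms(3)) auto
    ultimately show ?thesis using d(1) by simp
  qed simp
qed

text \<open>Cutting out cycles does not lower the weight, and a path uses each arc at most once. The
  bound does not depend on the length of the walk, which later keeps the supremum in the star
  finite.\<close>

lemma walk_weight_bounded:
  fixes w :: "('a::finite) \<times> 'a \<Rightarrow> real"
  assumes "walk u p v" "set p \<subseteq> E"
    and "\<And>z. is_cyc z \<Longrightarrow> set z \<subseteq> E \<Longrightarrow> sum_list (map w z) \<le> 0"
  shows "sum_list (map w p) \<le> (\<Sum>e\<in>UNIV. \<bar>w e\<bar>)"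
  using assms(1,2)
proof (induction "length p" arbitrary: p rule: less_induct)
  case less
  show ?case
  proof (cases "distinct (u # map snd p)")
    case True
    then have "distinct p" by (simp add: distinct_map)
    then have "sum_list (map w p) = sum w (set p)" by (simp add: sum_list_distinct_conv_sum_set)
    also have "\<dots> \<le> (\<Sum>e\<in>set p. \<bar>w e\<bar>)" by (intro sum_mono) auto
    also have "\<dots> \<le> (\<Sum>e\<in>UNIV. \<bar>w e\<bar>)" by (intro sum_mono2) auto
    finally show ?thesis .
  next
    case False
    from walk_contains_cycle[OF less.prems(1) this]
    obtain q z s x where d: "p = q @ z @ s" "walk u q x" "walk x z x" "walk x s v" "is_cyc z" by blast
    have "sum_list (map w (q @ s)) \<le> (\<Sum>e\<in>UNIV. \<bar>w e\<bar>)"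
      using d less.prems(2) by (intro less.hyps) (auto simp: walk_append is_cyc_def)
    moreover have "sum_list (map w z) \<le> 0" using d less.prems by (intro assms(3)) auto
    ultimately show ?thesis using d(1) by simp
  qed
qed

lemma sum_mset_mset: "(\<Sum>e\<in>#mset xs. f e) = sum_list (map f xs)"
  by (metis mset_map sum_mset_sum_list)

lemma walk_replicate: "walk u Q u \<Longrightarrow> walk u (concat (replicate m Q)) u"
  by (induction m) (auto intro: walk_appendI)

lemma sum_list_concat_replicate:
  "sum_list (map (w :: _ \<Rightarrow> real) (concat (replicate m Q))) = real m * sum_list (map w Q)"
  by (induction m) (auto simp: algebra_simps)

lemma length_concat_replicate: "length (concat (replicate m Q)) = m * length Q"
  by (induction m) auto

lemma set_concat_replicate: "set (concat (replicate m Q)) \<subseteq> set Q"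
  by (induction m) auto

lemma closed_walk_nodes:
  assumes "walk u Z u" "Z \<noteq> []"
  shows "fst ` set Z = snd ` set Z"
proof -
  have "u \<in> fst ` set Z" "u \<in> snd ` set Z"
    using walk_last[OF assms] walk_hd[OF assms] last_in_set[OF assms(2)] hd_in_set[OF assms(2)]
    by (auto intro: rev_image_eqI)
  then show ?thesis using walk_tails[OF assms(1)] by (simp add: insert_absorb)
qed

lemma is_cyc_rotate:
  assumes "is_cyc Z" "x \<in> fst ` set Z \<union> snd ` set Z"
  obtains Z' where "walk x Z' x" "mset Z' = mset Z"
proof -
  obtain z where z: "walk z Z z" "Z \<noteq> []" using assms(1) by (auto simp: is_cyc_def)
  then have "x \<in> insert z (snd ` set Z)" using closed_walk_nodes assms(2) by fastforce
  then obtain p1 p2 where "Z = p1 @ p2" "walk z p1 x" "walk x p2 z"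
    using walk_split_node[OF z(1)] by metis
  then show thesis using that[of "p2 @ p1"] by (auto simp: walk_append)
qed

lemma sum_list_mset_eq: "mset xs = mset ys \<Longrightarrow> sum_list (map (w :: _ \<Rightarrow> real) xs) = sum_list (map w ys)"
  by (metis mset_map sum_mset_sum_list)

text \<open>The rest of the closed walk leads from the head of \<open>e\<close> back to its tail; a
  path extracted from it closes \<open>e\<close> to a cycle.\<close>

lemma closed_walk_arc_on_cycle:
  assumes "walk u p u" "e \<in> set p"
  obtains Z where "is_cyc Z" "e \<in> set Z" "set Z \<subseteq> set p"
proof -
  obtain a b where ab: "p = a @ e # b" using assms(2) by (meson split_list)
  then have "walk (snd e) (b @ a) (fst e)" using assms(1) by (auto simp: walk_append)
  from path_decomposition[OF this]
  obtain r zs where r: "walk (snd e) r (fst e)" "distinct (snd e # map snd r)"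
    "mset (b @ a) = mset r + mset (concat zs)"
    by blast
  have "set r \<subseteq> set (b @ a)" using r(3) by (metis Un_upper1 mset_append set_append set_mset_mset)
  moreover have "is_cyc (e # r)" using r(1,2) by (auto simp: is_cyc_def)
  ultimately show thesis using ab by (intro that[of "e # r"]) auto
qed

lemma is_cyc_length: "is_cyc (z :: ('n::finite \<times> 'n) list) \<Longrightarrow> length z \<le> CARD('n)"
  using distinct_card[of "map snd z"] card_mono[of UNIV "set (map snd z)"] by (auto simp: is_cyc_def)

lemma path_length: "distinct (u # map snd p) \<Longrightarrow> length (p :: ('n::finite \<times> 'n) list) \<le> CARD('n) - 1"
  using distinct_card[of "u # map snd p"] card_mono[of UNIV "set (u # map snd p)"] by auto

definition visited :: "'a \<Rightarrow> ('a \<times> 'a) list \<Rightarrow> 'a set" where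
  "visited u p = insert u (snd ` set p)"

lemma visited_nodes: "walk u p v \<Longrightarrow> fst ` set p \<subseteq> visited u p \<and> snd ` set p \<subseteq> visited u p \<and> v \<in> visited u p"
  using walk_tails[of u p v] by (auto simp: visited_def)

lemma visited_path_length:
  fixes W :: "('n::finite \<times> 'n) list"
  assumes "walk i W j" "walk x r y" "distinct (x # map snd r)" "set r \<subseteq> set W"
  shows "length r \<le> card (visited i W) - 1"
proof (rule path_length_less_card[OF assms(2,3)])
  show "fst ` set r \<union> snd ` set r \<subseteq> visited i W"
    using visited_nodes[OF assms(1)] assms(4) by auto
qed simp

lemma card_cycle_nodes: "is_cyc Z \<Longrightarrow> card (snd ` set Z) = length Z"
  using distinct_card[of "map snd Z"] by (simp add: is_cyc_def)

text \<open>The minimum reflects that, up to its first node on \<open>Z\<close>, the walk only has the nodes off \<open>Z\<close>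
  available.\<close>

lemma touching_cycle_exchange:
  fixes W :: "('n::finite \<times> 'n) list"
  assumes Z: "is_cyc Z" and W: "walk i W j" and touch: "visited i W \<inter> snd ` set Z \<noteq> {}"
    and q: "\<And>x r y. walk x r y \<Longrightarrow> distinct (x # map snd r) \<Longrightarrow> set r \<subseteq> set W \<Longrightarrow> length r \<le> q"
    and long: "(length Z - 1) * (q + 1) + min (CARD('n) - length Z) q + q < length W"
  obtains p1 p2 zs k where "k \<in> snd ` set Z" "walk i p1 k" "walk k p2 j" "zs \<noteq> []"
    "\<forall>z\<in>set zs. is_cyc z" "length Z dvd length (concat zs)" "mset W = mset (p1 @ p2 @ concat zs)"
proof -
  define split where "split p \<longleftrightarrow> (\<exists>p2 k. W = p @ p2 \<and> walk i p k \<and> walk k p2 j \<and> k \<in> snd ` set Z)" for p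
  obtain k0 where k0: "k0 \<in> insert i (snd ` set W)" "k0 \<in> snd ` set Z" using touch by (auto simp: visited_def)
  then have "\<exists>p. split p" using walk_split_node[OF W k0(1)] unfolding split_def by metis
  \<comment> \<open>The shortest prefix ending on \<open>Z\<close> is chosen, so that all arcs of
    \<open>p1\<close> start off \<open>Z\<close>.\<close>
  then obtain p1 where p1: "split p1" and least: "\<And>p. split p \<Longrightarrow> length p1 \<le> length p"
    using ex_has_least_nat[of split _ length] by blast
  then obtain p2 k where p: "W = p1 @ p2" "walk i p1 k" "walk k p2 j" "k \<in> snd ` set Z"
    unfolding split_def by blast
  have avoid: "fst ` set p1 \<inter> snd ` set Z = {}"
  proof (rule ccontr)
    assume "\<not> ?thesis"
    then obtain e where e: "e \<in> set p1" "fst e \<in> snd ` set Z" by auto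
    obtain a b where ab: "p1 = a @ e # b" using e(1) by (meson split_list)
    have "walk i (a @ e # (b @ p2)) j" using W p(1) ab by simp
    then have "walk i a (fst e)" "walk (fst e) (e # (b @ p2)) j" by (auto simp: walk_append)
    then have "split a" unfolding split_def using e(2) p(1) ab by (intro exI[of _ "e # b @ p2"] exI[of _ "fst e"]) simp
    then show False using least[of a] ab by simp
  qed
  have sub: "fst ` set p1 \<union> snd ` set p1 \<subseteq> insert k (- (snd ` set Z))"
  proof -
    have "snd ` set p1 \<subseteq> insert k (fst ` set p1)" using walk_tails[OF p(2)] by blast
    then show ?thesis using avoid by blast
  qed
  \<comment> \<open>The nodes off \<open>Z\<close>, together with \<open>k\<close>, the only node of
    \<open>Z\<close> that \<open>p1\<close> can reach.\<close>
  have card: "card (insert k (- (snd ` set Z))) = CARD('n) - length Z + 1"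
    using p(4) card_cycle_nodes[OF Z] by (simp add: Compl_eq_Diff_UNIV card_Diff_subset)
  have q1: "length r \<le> min (CARD('n) - length Z) q"
    if r: "walk x r y" "distinct (x # map snd r)" "set r \<subseteq> set p1" for x r y
  proof -
    have "fst ` set r \<union> snd ` set r \<subseteq> fst ` set p1 \<union> snd ` set p1" using r(3) by blast
    then have "fst ` set r \<union> snd ` set r \<subseteq> insert k (- (snd ` set Z))" using sub by (rule order_trans)
    then have "length r \<le> card (insert k (- (snd ` set Z))) - 1"
      using path_length_less_card[OF r(1,2)] by simp
    moreover have "length r \<le> q" by (rule q[OF r(1,2)]) (use r(3) p(1) in auto)
    ultimately show ?thesis using card by simp
  qed
  have "0 < length Z" using Z by (simp add: is_cyc_def)
  have len: "(length Z - 1) * (q + 1) + min (CARD('n) - length Z) q + q < length p1 + length p2"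
    using long p(1) by simp
  have q2: "length r \<le> q" if "walk x r y" "distinct (x # map snd r)" "set r \<subseteq> set p2" for x r y
    using q[OF that(1,2)] that(3) p(1) by auto
  obtain p1' p2' zs where "walk i p1' k" "walk k p2' j" "zs \<noteq> []" "\<forall>z\<in>set zs. is_cyc z"
    "length Z dvd length (concat zs)" "mset (p1 @ p2) = mset (p1' @ p2' @ concat zs)"
    by (rule cycle_exchange[OF p(2,3) \<open>0 < length Z\<close> q1 q2 _ len]) auto
  then show thesis using that[of k p1' p2' zs] p(1,4) by auto
qed

lemma weight_concat_le:
  fixes f :: "'e \<Rightarrow> real"
  assumes "\<And>z. z \<in> set zs \<Longrightarrow> sum_list (map f z) \<le> c * real (length z)"
  shows "sum_list (map f (concat zs)) \<le> c * real (length (concat zs))"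
  using assms
proof (induction zs)
  case (Cons z zs)
  have "sum_list (map f z) \<le> c * real (length z)"
    "sum_list (map f (concat zs)) \<le> c * real (length (concat zs))" using Cons by auto
  then have "sum_list (map f (concat (z # zs))) \<le> c * real (length z) + c * real (length (concat zs))" by simp
  also have "\<dots> = c * real (length (concat (z # zs)))" by (simp add: algebra_simps)
  finally show ?case .
qed simp

section \<open>Walks in the presence of a Hamiltonian cycle\<close>

text \<open>This is the bound \<open>n\<close> on the Davenport constant of the cyclic group of
  order \<open>n\<close>: two of the \<open>n + 1\<close> prefix sums of \<open>n\<close> terms
  agree, and the terms between them sum to 0 modulo \<open>n\<close>.\<close>

lemma zero_sum_free_size_less:
  fixes f :: "'e \<Rightarrow> int"
  assumes "0 < n" and free: "\<And>F. F \<subseteq># M \<Longrightarrow> F \<noteq> {#} \<Longrightarrow> \<not> int n dvd (\<Sum>e\<in>#F. f e)"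
  shows "size M < n"
proof (rule ccontr)
  assume "\<not> size M < n"
  obtain xs where xs: "mset xs = M" using ex_mset by blast
  then have len: "n \<le> length xs" using \<open>\<not> size M < n\<close> by auto
  obtain i j where ij: "i < j" "j \<le> n"
    "[sum_list (map f (take i xs)) = sum_list (map f (take j xs))] (mod int n)"
    by (rule pigeonhole_mod[OF assms(1), of "\<lambda>i. sum_list (map f (take i xs))"]) blast
  define F where "F = drop i (take j xs)"
  have t: "take j xs = take i xs @ F"
    using ij(1) by (simp add: F_def) (metis append_take_drop_id min.absorb2 min.commute nat_less_le take_take)
  have "mset F \<subseteq># mset xs"
    using mset_subset_eq_add_right[of "mset F" "mset (take i xs)"]
    by (metis append_take_drop_id mset_append mset_subset_eq_add_left subset_mset.order_trans t)
  moreover have "F \<noteq> []" using ij len by (simp add: F_def)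
  moreover have "int n dvd sum_list (map f F)"
    using ij(3) by (simp add: t cong_iff_dvd_diff)
  ultimately show False using free[of "mset F"] xs by (simp add: sum_mset_mset)
qed

text \<open>Order \<open>M\<close> as \<open>a\<close>, \<open>b\<close>, rest. Its \<open>n\<close>
  prefix sums are pairwise incongruent, hence one of them is congruent to \<open>f b\<close>. It is
  not the empty one, as \<open>b\<close> alone would sum to 0. It does not contain both
  \<open>a\<close> and \<open>b\<close>, as removing \<open>b\<close> would leave a part with sum 0.
  So it is \<open>f a\<close>.\<close>

lemma zero_sum_free_cong:
  fixes f :: "'e \<Rightarrow> int"
  assumes "0 < n" "size M + 1 = n" "a \<in># M" "b \<in># M"
    and free: "\<And>F. F \<subseteq># M \<Longrightarrow> F \<noteq> {#} \<Longrightarrow> \<not> int n dvd (\<Sum>e\<in>#F. f e)"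
  shows "[f a = f b] (mod int n)"
proof (cases "a = b")
  case False
  then have "b \<in># M - {#a#}" using assms(4) by (simp add: in_diff_count)
  then obtain R where R: "M = add_mset a (add_mset b R)"
    using assms(3) by (metis insert_DiffM)
  obtain r where r: "mset r = R" using ex_mset by blast
  define xs where "xs = a # b # r"
  have xs: "mset xs = M" by (simp add: xs_def R r)
  then have len: "length xs + 1 = n" using assms(2) by auto
  \<comment> \<open>Indices below \<open>n\<close> are prefix lengths; index \<open>n\<close> holds
    the additional value \<open>f b\<close>.\<close>
  define g where "g m = (if m < n then sum_list (map f (take m xs)) else f b)" for m
  obtain i j where ij: "i < j" "j \<le> n" "[g i = g j] (mod int n)"
    using pigeonhole_mod[OF assms(1)] by metis
  show ?thesis
  proof (cases "j < n")
    case True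
    define F where "F = drop i (take j xs)"
    have t: "take j xs = take i xs @ F"
      using ij(1) by (simp add: F_def) (metis append_take_drop_id min.absorb2 min.commute nat_less_le take_take)
    have "mset F \<subseteq># mset xs"
      using mset_subset_eq_add_right[of "mset F" "mset (take i xs)"]
      by (metis append_take_drop_id mset_append mset_subset_eq_add_left subset_mset.order_trans t)
    moreover have "F \<noteq> []" using ij len True by (simp add: F_def)
    moreover have "int n dvd sum_list (map f F)"
      using ij True by (simp add: g_def t cong_iff_dvd_diff)
    ultimately show ?thesis using free[of "mset F"] xs by (simp add: sum_mset_mset)
  next
    case False
    then have c: "[sum_list (map f (take i xs)) = f b] (mod int n)" and "i < n"
      using ij by (auto simp: g_def)
    consider "i = 0" | "i = 1" | k where "i = Suc (Suc k)"
      by (metis One_nat_def not0_implies_Suc)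
    then show ?thesis
    proof cases
      case 1
      then have "int n dvd f b" using c by (simp add: cong_iff_dvd_diff)
      then show ?thesis using free[of "{#b#}"] assms(4) by simp
    next
      case 2
      then show ?thesis using c by (simp add: xs_def)
    next
      case 3
      then have "int n dvd f a + sum_list (map f (take k r))"
        using c by (simp add: xs_def cong_iff_dvd_diff algebra_simps)
      moreover have "mset (take k r) \<subseteq># R"
        using r by (metis append_take_drop_id mset_append mset_subset_eq_add_left)
      then have "add_mset a (mset (take k r)) \<subseteq># M"
        unfolding R by (simp add: subset_mset.order_trans[OF _ mset_subset_eq_add_right[of R "{#b#}"], simplified])
      ultimately show ?thesis using free[of "add_mset a (mset (take k r))"]
        by (simp add: sum_mset_mset)
    qed
  qed
qed simp

lemma walk_take_drop:
  assumes "walk u p v" "i < length p"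
  shows "walk u (take i p) (fst (p ! i))" "walk (fst (p ! i)) (drop i p) v"
proof -
  obtain w where w: "walk u (take i p) w" "walk w (drop i p) v"
    using assms(1) by (metis append_take_drop_id walk_append)
  then have "w = fst (p ! i)" using walk_hd[OF w(2)] assms(2) by (simp add: hd_drop_conv_nth)
  then show "walk u (take i p) (fst (p ! i))" "walk (fst (p ! i)) (drop i p) v" using w by auto
qed

text \<open>\<open>pos\<close> numbers the nodes along \<open>Z\<close>, and \<open>h\<close> is the
  weight of the part of \<open>Z\<close> before a node. A segment that wraps around the start of
  \<open>Z\<close> obeys the same weight formula because \<open>Z\<close> has weight 0.\<close>

lemma hamiltonian_segments:
  fixes Z :: "('n::finite \<times> 'n) list" and w :: "'n \<times> 'n \<Rightarrow> real"
  assumes "is_cyc Z" "length Z = CARD('n)" "sum_list (map w Z) = 0"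
  obtains pos :: "'n \<Rightarrow> int" and h :: "'n \<Rightarrow> real" where
    "\<And>x y. \<exists>s. walk x s y \<and> set s \<subseteq> set Z \<and> int (length s) = (pos y - pos x) mod int CARD('n) \<and>
      sum_list (map w s) = h y - h x"
proof -
  obtain z where z: "walk z Z z" "Z \<noteq> []" "distinct (map snd Z)" using assms(1) by (auto simp: is_cyc_def)
  have "card (snd ` set Z) = CARD('n)" using distinct_card[OF z(3)] assms(2) by simp
  then have "snd ` set Z = UNIV" by (simp add: card_eq_UNIV_imp_eq_UNIV)
  moreover have "z \<in> fst ` set Z" using walk_hd[OF z(1,2)] hd_in_set[OF z(2)] by auto
  ultimately have "fst ` set Z = UNIV" using walk_tails[OF z(1)] by auto
  then have "\<forall>x. \<exists>i. i < length Z \<and> fst (Z ! i) = x" by (metis UNIV_I image_iff in_set_conv_nth)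
  then obtain pos where pos: "\<And>x. pos x < length Z" "\<And>x. fst (Z ! pos x) = x" by metis
  define h where "h x = sum_list (map w (take (pos x) Z))" for x
  have "\<exists>s. walk x s y \<and> set s \<subseteq> set Z \<and> int (length s) = (int (pos y) - int (pos x)) mod int CARD('n) \<and>
      sum_list (map w s) = h y - h x" for x y
  proof (cases "pos x \<le> pos y")
    case True
    define s where "s = drop (pos x) (take (pos y) Z)"
    have t: "take (pos y) Z = take (pos x) Z @ s"
      using True by (simp add: s_def) (metis append_take_drop_id min.absorb2 min.commute take_take)
    have "walk z (take (pos y) Z) y" "walk z (take (pos x) Z) x"
      using walk_take_drop(1)[OF z(1) pos(1)] pos(2) by auto
    then have "walk x s y" unfolding t by (metis walk_append walk_unique_end)
    moreover have "set s \<subseteq> set Z" unfolding s_def by (meson set_drop_subset set_take_subset order_trans)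
    moreover have "int (length s) = (int (pos y) - int (pos x)) mod int CARD('n)"
      using True pos(1)[of y] assms(2) by (simp add: s_def of_nat_diff)
    moreover have "sum_list (map w s) = h y - h x" by (simp add: h_def t)
    ultimately show ?thesis by blast
  next
    case False
    define s where "s = drop (pos x) Z @ take (pos y) Z"
    have "walk x (drop (pos x) Z) z" "walk z (take (pos y) Z) y"
      using walk_take_drop[OF z(1) pos(1)] pos(2) by metis+
    then have "walk x s y" by (auto simp: s_def walk_append)
    moreover have "set s \<subseteq> set Z" unfolding s_def using set_drop_subset set_take_subset by fastforce
    moreover have "int (length s) = (int (pos y) - int (pos x)) mod int CARD('n)"
    proof -
      have "int (length s) = (int (pos y) - int (pos x)) + int CARD('n)"
        using pos(1)[of x] pos(1)[of y] assms(2) by (simp add: s_def of_nat_diff)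
      moreover have "\<dots> = (\<dots>) mod int CARD('n)"
        using False pos(1)[of x] pos(1)[of y] assms(2) by (intro mod_pos_pos_trivial[symmetric]) auto
      ultimately show ?thesis by simp
    qed
    moreover have "sum_list (map w s) = h y - h x"
    proof -
      have "sum_list (map w (take (pos x) Z @ drop (pos x) Z)) = 0" using assms(3) by simp
      then show ?thesis by (simp only: s_def h_def map_append sum_list_append)
    qed
    ultimately show ?thesis by blast
  qed
  then show thesis by (rule that)
qed

text \<open>Cutting out cycles guarantees only a length of at most \<open>n\<^sup>2 - 1\<close>
  here, which misses the bound \<open>Wi n + n = n\<^sup>2 - n + 2\<close> from \<open>n = 3\<close>
  on. Instead few arcs of \<open>W\<close> are kept, and \<open>Z\<close> supplies connections
  between them that cost nothing relative to the potential.\<close>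

lemma hamiltonian_shortening:
  fixes Z W :: "('n::finite \<times> 'n) list" and w :: "'n \<times> 'n \<Rightarrow> real"
  assumes Z: "is_cyc Z" "length Z = CARD('n)" "sum_list (map w Z) = 0" "set Z \<subseteq> E"
    and W: "walk i W j" "set W \<subseteq> E"
    and neg: "\<And>z. is_cyc z \<Longrightarrow> set z \<subseteq> E \<Longrightarrow> sum_list (map w z) \<le> 0"
  obtains V where "walk i V j" "set V \<subseteq> E" "[length V = length W] (mod CARD('n))"
    "length V < Wi CARD('n) + CARD('n)" "sum_list (map w W) \<le> sum_list (map w V)"
proof -
  let ?n = "CARD('n)"
  note result = that
  have n: "0 < ?n" by simp
  obtain pos h where seg: "\<And>x y. \<exists>s. walk x s y \<and> set s \<subseteq> set Z \<and>
      int (length s) = (pos y - pos x) mod int ?n \<and> sum_list (map w s) = h y - (h x :: real)"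
    using hamiltonian_segments[OF Z(1-3)] by blast
  \<comment> \<open>Relative to the potential \<open>h\<close> the arcs of \<open>Z\<close> weigh 0 and all other arcs at most 0;
    \<open>d e\<close> is the position gained by \<open>e\<close> in excess of one step along \<open>Z\<close>.\<close>
  define v where "v e = w e + h (fst e) - h (snd e)" for e
  define d where "d e = pos (snd e) - pos (fst e) - 1" for e
  have v_neg: "v e \<le> 0" if e: "e \<in> E" for e
  proof -
    obtain s where s: "walk (snd e) s (fst e)" "set s \<subseteq> set Z" "sum_list (map w s) = h (fst e) - h (snd e)"
      using seg by blast
    have "sum_list (map w (e # s)) \<le> 0"
      by (rule closed_walk_weight_le_0[OF _ _ neg, of "fst e" _ E]) (use s e Z(4) in auto)
    then show ?thesis using s(3) by (simp add: v_def)
  qed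
  \<comment> \<open>By telescoping, fixing the length of a walk with given ends modulo
    \<open>n\<close> amounts to fixing its sum of \<open>d\<close> modulo \<open>n\<close>.\<close>
  have tele: "sum_list (map w p) = sum_list (map v p) + h y - h x \<and>
      int (length p) = pos y - pos x - sum_list (map d p)" if "walk x p y" for x p y
    using that by (induction p arbitrary: x) (auto simp: v_def d_def)
  have reconnect: "\<exists>V. walk x V j \<and> set V \<subseteq> E \<and> sum_list (map v V) = sum_list (map v es) \<and>
      [sum_list (map d V) = sum_list (map d es)] (mod int ?n) \<and>
      length V \<le> (length es + 1) * (?n - 1) + length es" if "set es \<subseteq> E" for es x
    using that
  proof (induction es arbitrary: x)
    case Nil
    obtain s where s: "walk x s j" "set s \<subseteq> set Z" "int (length s) = (pos j - pos x) mod int ?n"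
      "sum_list (map w s) = h j - h x" using seg by blast
    have "int (length s) < int ?n" using s(3) by simp
    then have "length s \<le> ?n - 1" by linarith
    moreover have "[sum_list (map d s) = 0] (mod int ?n)"
    proof -
      have "sum_list (map d s) = (pos j - pos x) - (pos j - pos x) mod int ?n"
        using tele[OF s(1)] s(3) by linarith
      then show ?thesis by (simp add: cong_iff_dvd_diff)
    qed
    ultimately show ?case using s tele[OF s(1)] Z(4) by (intro exI[of _ s]) auto
  next
    case (Cons e es)
    obtain s where s: "walk x s (fst e)" "set s \<subseteq> set Z" "int (length s) = (pos (fst e) - pos x) mod int ?n"
      "sum_list (map w s) = h (fst e) - h x" using seg by blast
    have "int (length s) < int ?n" using s(3) by simp
    then have ls: "length s \<le> ?n - 1" by linarith
    have ds: "[sum_list (map d s) = 0] (mod int ?n)"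
    proof -
      have "sum_list (map d s) = (pos (fst e) - pos x) - (pos (fst e) - pos x) mod int ?n"
        using tele[OF s(1)] s(3) by linarith
      then show ?thesis by (simp add: cong_iff_dvd_diff)
    qed
    obtain V where V: "walk (snd e) V j" "set V \<subseteq> E" "sum_list (map v V) = sum_list (map v es)"
      "[sum_list (map d V) = sum_list (map d es)] (mod int ?n)"
      "length V \<le> (length es + 1) * (?n - 1) + length es" using Cons by (metis list.set_intros(2) subset_iff)
    have "[sum_list (map d s) + (d e + sum_list (map d V)) = 0 + (d e + sum_list (map d es))] (mod int ?n)"
      using ds V(4) by (intro cong_add) auto
    then show ?case using s V ls tele[OF s(1)] Z(4) Cons.prems
      by (intro exI[of _ "s @ e # V"]) (auto simp: walk_append)
  qed
  have repeat: "\<exists>V. walk (snd e) V j \<and> set V \<subseteq> E \<and> sum_list (map v V) = real m * v e \<and>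
      [sum_list (map d V) = int m * d e] (mod int ?n) \<and>
      length V \<le> (m + 1) * (?n - 1)" if e: "e \<in> E" "\<not> int ?n dvd d e" for e m
  proof (induction m)
    case 0
    then show ?case using reconnect[of "[]" "snd e"] by auto
  next
    case (Suc m)
    obtain s where s: "walk (snd e) s (fst e)" "set s \<subseteq> set Z" "int (length s) = (pos (fst e) - pos (snd e)) mod int ?n"
      "sum_list (map w s) = h (fst e) - h (snd e)" using seg by blast
    have eq: "sum_list (map d s) = (pos (fst e) - pos (snd e)) - (pos (fst e) - pos (snd e)) mod int ?n"
      using tele[OF s(1)] s(3) by linarith
    then have ds: "[sum_list (map d s) = 0] (mod int ?n)" by (simp add: cong_iff_dvd_diff)
    have "int (length s) < int ?n" using s(3) by simp
    \<comment> \<open>A return of \<open>n - 1\<close> arcs would mean that \<open>e\<close> itself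
      advances one step along \<open>Z\<close>, that is, \<open>d e\<close> would be divisible by
      \<open>n\<close>. A return together with \<open>e\<close> thus costs at most
      \<open>n - 1\<close> arcs.\<close>
    moreover have "int (length s) \<noteq> int ?n - 1"
    proof
      assume "int (length s) = int ?n - 1"
      then have "sum_list (map d s) = - d e - int ?n" using eq s(3) by (simp add: d_def)
      then have "int ?n dvd - d e - int ?n" using ds by (simp add: cong_iff_dvd_diff)
      then have "int ?n dvd (- d e - int ?n) + int ?n" by (intro dvd_add) auto
      then show False using e(2) by simp
    qed
    ultimately have ls: "length s + 1 \<le> ?n - 1" by linarith
    obtain V where V: "walk (snd e) V j" "set V \<subseteq> E" "sum_list (map v V) = real m * v e"
      "[sum_list (map d V) = int m * d e] (mod int ?n)" "length V \<le> (m + 1) * (?n - 1)" using Suc by blast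
    have "[sum_list (map d s) + (d e + sum_list (map d V)) = 0 + (d e + int m * d e)] (mod int ?n)"
      using ds V(4) by (intro cong_add) auto
    moreover have "length (s @ e # V) \<le> (Suc m + 1) * (?n - 1)"
    proof -
      have "length (s @ e # V) = length s + 1 + length V" by simp
      also have "\<dots> \<le> (?n - 1) + (m + 1) * (?n - 1)" using ls V(5) by linarith
      also have "\<dots> = Suc (m + 1) * (?n - 1)" by (simp only: mult_Suc)
      finally show ?thesis by simp
    qed
    ultimately show ?case using s V(1-4) tele[OF s(1)] Z(4) e
      by (intro exI[of _ "s @ e # V"]) (auto simp: walk_append algebra_simps)
  qed
  \<comment> \<open>Only the residue of the \<open>d\<close>-sum must survive. Dropping the other
    arcs of \<open>W\<close> is harmless since \<open>v\<close> is at most 0 on them.\<close>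
  define ok where "ok M \<longleftrightarrow> M \<subseteq># mset W \<and> [(\<Sum>e\<in>#M. d e) = sum_list (map d W)] (mod int ?n)" for M
  have "ok (mset W)" by (simp add: ok_def sum_mset_mset)
  then obtain M where M: "ok M" and least: "\<And>N. ok N \<Longrightarrow> size M \<le> size N"
    using ex_has_least_nat[of ok _ size] by blast
  have ME: "e \<in> E" if "e \<in># M" for e
    using that M W(2) mset_subset_eqD unfolding ok_def by fastforce
  have free: "\<not> int ?n dvd (\<Sum>e\<in>#F. d e)" if F: "F \<subseteq># M" "F \<noteq> {#}" for F
  proof
    assume dv: "int ?n dvd (\<Sum>e\<in>#F. d e)"
    have MF: "M = (M - F) + F" using F by simp
    have "(\<Sum>e\<in>#M. d e) = (\<Sum>e\<in>#M - F. d e) + (\<Sum>e\<in>#F. d e)"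
      by (subst MF) (simp only: image_mset_union sum_mset.union)
    then have "[(\<Sum>e\<in>#M - F. d e) = (\<Sum>e\<in>#M. d e)] (mod int ?n)"
      using dv by (simp add: cong_iff_dvd_diff)
    then have "ok (M - F)" using M by (auto simp: ok_def intro: cong_trans subset_mset.order_trans[OF diff_subset_eq_self])
    then have "size M \<le> size (M - F)" by (rule least)
    moreover have "size M = size (M - F) + size F" by (subst MF) (simp only: size_union)
    ultimately show False using F(2) by simp
  qed
  have size: "size M < ?n" using zero_sum_free_size_less[OF n free] .
  have vM: "sum_list (map v W) \<le> (\<Sum>e\<in>#M. v e)"
  proof -
    have MW: "mset W = (mset W - M) + M" using M by (simp add: ok_def)
    have "(\<Sum>e\<in>#mset W. v e) = (\<Sum>e\<in>#mset W - M. v e) + (\<Sum>e\<in>#M. v e)"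
      by (subst MW) (simp only: image_mset_union sum_mset.union)
    moreover have "(\<Sum>e\<in>#mset W - M. v e) \<le> (\<Sum>e\<in>#mset W - M. 0)"
      using W(2) v_neg by (intro sum_mset_mono) (auto dest!: in_diffD)
    ultimately show ?thesis by (simp add: sum_mset_mset)
  qed
  have finish: thesis if V: "walk i V j" "set V \<subseteq> E" "(\<Sum>e\<in>#M. v e) \<le> sum_list (map v V)"
    "[sum_list (map d V) = (\<Sum>e\<in>#M. d e)] (mod int ?n)" "length V < Wi ?n + ?n" for V
  proof (rule result[OF V(1,2) _ V(5)])
    have "[sum_list (map d V) = sum_list (map d W)] (mod int ?n)"
      using V(4) M unfolding ok_def by (blast intro: cong_trans)
    then have "[int (length V) = int (length W)] (mod int ?n)"
      unfolding conjunct2[OF tele[OF V(1)]] conjunct2[OF tele[OF W(1)]] by (intro cong_diff) auto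
    then show "[length V = length W] (mod ?n)" by (simp add: cong_int_iff)
    show "sum_list (map w W) \<le> sum_list (map w V)"
      using V(3) vM tele[OF V(1)] tele[OF W(1)] by linarith
  qed
  show thesis
  proof (cases "?n = 1 \<or> size M + 2 \<le> ?n")
    case True
    obtain es where es: "mset es = M" using ex_mset by blast
    obtain V where V: "walk i V j" "set V \<subseteq> E" "sum_list (map v V) = sum_list (map v es)"
      "[sum_list (map d V) = sum_list (map d es)] (mod int ?n)"
      "length V \<le> (length es + 1) * (?n - 1) + length es"
      using reconnect[of es i] ME es by (metis set_mset_mset subsetI)
    \<comment> \<open>Apart from \<open>n = 1\<close>, at most \<open>n - 2\<close> arcs are kept,
      so there are at most \<open>n - 1\<close> connections of at most \<open>n - 1\<close> arcs
      each.\<close>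
    have "(length es + 1) * (?n - 1) + length es < Wi ?n + ?n"
    proof (cases "?n = 1")
      case True
      then show ?thesis using size es by auto
    next
      case False
      define k where "k = ?n - 1"
      have k: "?n = k + 1" by (simp add: k_def)
      have "length es + 1 \<le> k" using True False es k by auto
      then have "(length es + 1) * k \<le> k * k" by (intro mult_right_mono) auto
      then show ?thesis using \<open>length es + 1 \<le> k\<close> False unfolding k Wi_def by (simp add: power2_eq_square)
    qed
    then show thesis using V es by (intro finish[of V]) (auto simp: sum_mset_mset)
  next
    case False
    \<comment> \<open>All \<open>d\<close>-values on \<open>M\<close> are now congruent, so every arc of \<open>M\<close> may be replaced by the
      best one; this saves length because each return along \<open>Z\<close> is then short.\<close>
    then have sM: "size M + 1 = ?n" and n2: "2 \<le> ?n" using size by auto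
    then have "M \<noteq> {#}" by auto
    then obtain e where e: "e \<in># M" "\<And>f. f \<in># M \<Longrightarrow> v f \<le> v e"
      using Max_in[of "v ` set_mset M"] Max_ge[of "v ` set_mset M"] by (smt (verit) finite_imageI finite_set_mset image_iff image_is_empty imageI set_mset_eq_empty_iff)
    have de: "\<not> int ?n dvd d e" using free[of "{#e#}"] e(1) by simp
    \<comment> \<open>One copy of \<open>e\<close> followed by the \<open>n - 2\<close> copies in
      \<open>V\<close> takes the place of the \<open>n - 1\<close> arcs of \<open>M\<close>.\<close>
    obtain V where V: "walk (snd e) V j" "set V \<subseteq> E" "sum_list (map v V) = real (?n - 2) * v e"
      "[sum_list (map d V) = int (?n - 2) * d e] (mod int ?n)" "length V \<le> (?n - 2 + 1) * (?n - 1)"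
      using repeat[OF ME[OF e(1)] de] by blast
    obtain s where s: "walk i s (fst e)" "set s \<subseteq> set Z" "int (length s) = (pos (fst e) - pos i) mod int ?n"
      "sum_list (map w s) = h (fst e) - h i" using seg by blast
    have "sum_list (map d s) = (pos (fst e) - pos i) - (pos (fst e) - pos i) mod int ?n"
      using tele[OF s(1)] s(3) by linarith
    then have ds: "[sum_list (map d s) = 0] (mod int ?n)" by (simp add: cong_iff_dvd_diff)
    have "int (length s) < int ?n" using s(3) by simp
    then have ls: "length s \<le> ?n - 1" by linarith
    have vs: "sum_list (map v s) = 0" using tele[OF s(1)] s(4) by linarith
    have "(\<Sum>f\<in>#M. v f) \<le> (\<Sum>f\<in>#M. v e)" using e(2) by (intro sum_mset_mono) auto
    also have "\<dots> = real (?n - 1) * v e" using sM by simp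
    also have "\<dots> = sum_list (map v (s @ e # V))"
      using n2 vs V(3) by (simp add: of_nat_diff algebra_simps)
    finally have 1: "(\<Sum>f\<in>#M. v f) \<le> sum_list (map v (s @ e # V))" .
    have "[(\<Sum>f\<in>#M. d f) = (\<Sum>f\<in>#M. d e)] (mod int ?n)"
    proof -
      have "[d f = d e] (mod int ?n)" if "f \<in># M" for f
        using zero_sum_free_cong[OF n sM that e(1) free] .
      then have "(\<And>f. f \<in># N \<Longrightarrow> f \<in># M) \<Longrightarrow> [(\<Sum>f\<in>#N. d f) = (\<Sum>f\<in>#N. d e)] (mod int ?n)" for N
        by (induction N) (auto intro: cong_add)
      then show ?thesis by blast
    qed
    also have "(\<Sum>f\<in>#M. d e) = int (size M) * d e" by simp
    also have "int (size M) = 1 + int (?n - 2)" using sM n2 by linarith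
    also have "(1 + int (?n - 2)) * d e = 0 + (d e + int (?n - 2) * d e)"
      by (simp only: add_0 distrib_right mult_1)
    also have "[\<dots> = sum_list (map d (s @ e # V))] (mod int ?n)"
      using cong_add[OF ds cong_add[OF cong_refl V(4)]] by (simp add: cong_sym_eq)
    finally have 2: "[sum_list (map d (s @ e # V)) = (\<Sum>f\<in>#M. d f)] (mod int ?n)"
      by (simp add: cong_sym_eq)
    have "length (s @ e # V) \<le> (?n - 1) + 1 + (?n - 1) * (?n - 1)"
      using V(5) ls n2 by (simp add: Suc_diff_Suc numeral_2_eq_2)
    also have "\<dots> < Wi ?n + ?n" using n2 by (simp add: Wi_def power2_eq_square)
    finally have 3: "length (s @ e # V) < Wi ?n + ?n" .
    show thesis by (rule finish[OF _ _ 1 2 3]) (use s V Z(4) ME[OF e(1)] in \<open>auto simp: walk_append\<close>)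
  qed
qed

section \<open>Matrix powers as walk weights\<close>

definition edges :: "'n mp_matrix \<Rightarrow> ('n \<times> 'n) set" where
  "edges A = {e. A (fst e) (snd e) \<noteq> -\<infinity>}"

definition entry :: "'n mp_matrix \<Rightarrow> 'n \<times> 'n \<Rightarrow> real" where
  "entry A e = real_of_ereal (A (fst e) (snd e))"

section \<open>Arc-list walks as walks, paths and cycles of the digraph\<close>

lemma cas_eq_walk:
  assumes "tail G = fst" "head G = snd"
  shows "pre_digraph.cas G u p v \<longleftrightarrow> walk u p v"
  by (induction p arbitrary: u) (auto simp: pre_digraph.cas.simps assms)

lemma awalk_iff_walk:
  assumes "tail G = fst" "head G = snd"
  shows "pre_digraph.awalk G u p v \<longleftrightarrow> u \<in> verts G \<and> set p \<subseteq> arcs G \<and> walk u p v"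
  by (simp add: pre_digraph.awalk_def cas_eq_walk[OF assms])

lemma awalk_verts_walk:
  assumes "tail G = fst" "head G = snd" "walk u p v"
  shows "pre_digraph.awalk_verts G u p = u # map snd p"
  using assms(3)
  by (induction p arbitrary: u) (auto simp: pre_digraph.awalk_verts.simps assms(1,2))

lemma mp_digraph_simps [simp]:
  "verts (mp_digraph A) = UNIV" "arcs (mp_digraph A) = edges A"
  "tail (mp_digraph A) = fst" "head (mp_digraph A) = snd"
  by (auto simp: mp_digraph_def edges_def)

lemma cycle_mp_digraph: "pre_digraph.cycle (mp_digraph A) p \<longleftrightarrow> is_cyc p \<and> set p \<subseteq> edges A"
proof -
  have "pre_digraph.awalk_verts (mp_digraph A) u p = u # map snd p" if "walk u p u" for u
    using that by (intro awalk_verts_walk) auto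
  then show ?thesis
    by (auto simp: pre_digraph.cycle_def awalk_iff_walk is_cyc_def)
qed

lemma mp_cycle_iff: "mp_cycle A p \<longleftrightarrow> is_cyc p \<and> set p \<subseteq> edges A"
  by (simp add: mp_cycle_def cycle_mp_digraph)

lemma apath_mp_digraph:
  "pre_digraph.apath (mp_digraph A) u p v \<longleftrightarrow> walk u p v \<and> set p \<subseteq> edges A \<and> distinct (u # map snd p)"
proof -
  have "pre_digraph.awalk_verts (mp_digraph A) u p = u # map snd p" if "walk u p v"
    using that by (intro awalk_verts_walk) auto
  then show ?thesis
    by (cases "walk u p v") (simp_all add: pre_digraph.apath_def awalk_iff_walk)
qed

lemma path_length_le_cd:
  fixes A :: "'n::finite mp_matrix"
  assumes "walk u p v" "set p \<subseteq> edges A" "distinct (u # map snd p)"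
  shows "length p \<le> cd (mp_digraph A)"
proof -
  have "length W \<le> CARD('n)" if "pre_digraph.apath (mp_digraph A) u W v" for u W v
    using that path_length[of u W] unfolding apath_mp_digraph by (meson diff_le_self le_trans)
  then have "{length W | W. \<exists>u v. pre_digraph.apath (mp_digraph A) u W v} \<subseteq> {..CARD('n)}"
    by blast
  then have "finite {length W | W. \<exists>u v. pre_digraph.apath (mp_digraph A) u W v}"
    by (rule finite_subset) simp
  moreover have "pre_digraph.apath (mp_digraph A) u p v" using assms by (simp add: apath_mp_digraph)
  ultimately show ?thesis unfolding cd_def by (intro Max_ge) blast+
qed

lemma cycle_length_le_cr:
  fixes A :: "'n::finite mp_matrix"
  assumes "is_cyc z" "set z \<subseteq> edges A"
  shows "length z \<le> cr (mp_digraph A)"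
proof -
  have "{length Z | Z. pre_digraph.cycle (mp_digraph A) Z} \<subseteq> {..CARD('n)}"
    using is_cyc_length unfolding cycle_mp_digraph by blast
  then have "finite {length Z | Z. pre_digraph.cycle (mp_digraph A) Z}"
    by (rule finite_subset) simp
  moreover have "pre_digraph.cycle (mp_digraph A) z" using assms by (simp add: cycle_mp_digraph)
  ultimately show ?thesis unfolding cr_def by (intro Max_ge) blast+
qed

lemma finite_cycles: "finite {z :: ('n::finite \<times> 'n) list. is_cyc z}"
  by (rule finite_subset[OF _ finite_lists_length_le[of UNIV "CARD('n)"]]) (auto intro: is_cyc_length)

lemma mean_eq: "mean A Z = sum_list (map (entry A) Z) / real (length Z)"
  by (simp add: mean_def weight_def entry_def[abs_def])

lemma finite_means: "finite {mean A Z | Z. mp_cycle (A :: 'n::finite mp_matrix) Z}"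
  by (rule finite_subset[OF _ finite_imageI[OF finite_cycles, of "mean A"]]) (auto simp: mp_cycle_iff)

lemma max_cycle_mean_real:
  fixes A :: "'n::finite mp_matrix"
  assumes "max_cycle_mean A \<noteq> -\<infinity>"
  obtains l where "max_cycle_mean A = ereal l" "\<And>Z. mp_cycle A Z \<Longrightarrow> mean A Z \<le> l"
    "\<exists>Z. mp_cycle A Z \<and> mean A Z = l"
proof -
  have ex: "\<exists>Z. mp_cycle A Z" using assms by (auto simp: max_cycle_mean_def split: if_splits)
  let ?S = "{mean A Z | Z. mp_cycle A Z}"
  have "Max ?S \<in> ?S" using ex finite_means by (intro Max_in) auto
  then have "\<exists>Z. mp_cycle A Z \<and> mean A Z = Max ?S" by auto
  moreover have "mean A Z \<le> Max ?S" if "mp_cycle A Z" for Z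
    using that finite_means by (intro Max_ge) auto
  moreover have "max_cycle_mean A = ereal (Max ?S)" using ex by (simp add: max_cycle_mean_def)
  ultimately show thesis using that by blast
qed

lemma mp_mult_ge: "A i k + B k j \<le> mp_mult A B i (j :: 'n::finite)"
  by (auto simp: mp_mult_def)

lemma mp_mult_attained: "\<exists>k. mp_mult A B i j = A i k + B k (j :: 'n::finite)"
proof -
  have "Max (range (\<lambda>k. A i k + B k j)) \<in> range (\<lambda>k. A i k + B k j)" by (intro Max_in) auto
  then show ?thesis unfolding mp_mult_def by blast
qed

lemma mp_mult_le: "(\<And>k. A i k + B k j \<le> x) \<Longrightarrow> mp_mult A B i (j :: 'n::finite) \<le> x"
  using mp_mult_attained[of A B i j] by metis

lemma max_plus_mult: "max_plus_matrix A \<Longrightarrow> max_plus_matrix B \<Longrightarrow> max_plus_matrix (mp_mult A B)"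
  unfolding max_plus_matrix_def
proof (intro allI)
  fix i j assume *: "\<forall>i j. A i j \<noteq> \<infinity>" "\<forall>i j. B i j \<noteq> \<infinity>"
  obtain k where "mp_mult A B i j = A i k + B k j" using mp_mult_attained by metis
  then show "mp_mult A B i j \<noteq> \<infinity>" using * by simp
qed

lemma max_plus_power: "max_plus_matrix A \<Longrightarrow> max_plus_matrix (mp_power A t)"
proof (induction t)
  case 0
  then show ?case by (simp add: max_plus_matrix_def mp_one_def)
qed (simp add: max_plus_mult)

lemma entry_eq:
  assumes "max_plus_matrix A" "e \<in> edges A"
  shows "A (fst e) (snd e) = ereal (entry A e)"
  using assms by (cases "A (fst e) (snd e)") (auto simp: max_plus_matrix_def edges_def entry_def)

lemma mp_power_ge_walk:
  assumes "max_plus_matrix A" "walk i W j" "set W \<subseteq> edges A"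
  shows "ereal (sum_list (map (entry A) W)) \<le> mp_power A (length W) i j"
  using assms(2,3)
proof (induction W arbitrary: i)
  case Nil
  then show ?case by (simp add: mp_one_def zero_ereal_def)
next
  case (Cons e W)
  then have "ereal (entry A e) = A i (snd e)" using entry_eq[OF assms(1)] by fastforce
  moreover have "ereal (sum_list (map (entry A) W)) \<le> mp_power A (length W) (snd e) j"
    using Cons by auto
  ultimately have "ereal (entry A e) + ereal (sum_list (map (entry A) W)) \<le> A i (snd e) + mp_power A (length W) (snd e) j"
    by (intro add_mono) auto
  also have "\<dots> \<le> mp_power A (length (e # W)) i j" using mp_mult_ge by simp
  finally show ?case by simp
qed

lemma mp_power_walk:
  assumes "max_plus_matrix A" "mp_power A t i j \<noteq> -\<infinity>"
  obtains W where "walk i W j" "set W \<subseteq> edges A" "length W = t"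
    "mp_power A t i j = ereal (sum_list (map (entry A) W))"
proof -
  have "\<exists>W. walk i W j \<and> set W \<subseteq> edges A \<and> length W = t \<and>
    mp_power A t i j = ereal (sum_list (map (entry A) W))" using assms(2)
  proof (induction t arbitrary: i)
    case 0
    then show ?case by (intro exI[of _ "[]"]) (auto simp: mp_one_def zero_ereal_def split: if_splits)
  next
    case (Suc t)
    obtain k where k: "mp_power A (Suc t) i j = A i k + mp_power A t k j"
      using mp_mult_attained[of A "mp_power A t" i j] by auto
    have "A i k \<noteq> \<infinity>" "mp_power A t k j \<noteq> \<infinity>" using assms(1) max_plus_power[OF assms(1)]
      by (auto simp: max_plus_matrix_def)
    then have "A i k \<noteq> -\<infinity>" "mp_power A t k j \<noteq> -\<infinity>" using k Suc.prems by auto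
    then have e: "(i, k) \<in> edges A" by (simp add: edges_def)
    obtain W where "walk k W j" "set W \<subseteq> edges A" "length W = t"
      "mp_power A t k j = ereal (sum_list (map (entry A) W))"
      using Suc.IH[OF \<open>mp_power A t k j \<noteq> -\<infinity>\<close>] by blast
    then show ?case using k e entry_eq[OF assms(1) e] by (intro exI[of _ "(i, k) # W"]) auto
  qed
  then show thesis using that by blast
qed

text \<open>A walk of length \<open>g * k\<close> is read as \<open>k\<close> blocks of length
  \<open>g\<close>, one for each factor of the outer power.\<close>

lemma mp_power_power_ge:
  assumes "max_plus_matrix A" "walk i W j" "set W \<subseteq> edges A" "length W = g * k"
  shows "ereal (sum_list (map (entry A) W)) \<le> mp_power (mp_power A g) k i j"
  using assms(2-4)
proof (induction k arbitrary: i W)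
  case 0
  then show ?case by (simp add: mp_one_def zero_ereal_def)
next
  case (Suc k)
  obtain l where l: "walk i (take g W) l" "walk l (drop g W) j"
    using Suc.prems(1) by (metis append_take_drop_id walk_append)
  have len: "length (take g W) = g" "length (drop g W) = g * k" using Suc.prems(3) by auto
  have sub: "set (take g W) \<subseteq> edges A" "set (drop g W) \<subseteq> edges A"
    using Suc.prems(2) set_take_subset set_drop_subset by fast+
  have "ereal (sum_list (map (entry A) (take g W @ drop g W))) =
      ereal (sum_list (map (entry A) (take g W))) + ereal (sum_list (map (entry A) (drop g W)))"
    by (simp only: map_append sum_list_append plus_ereal.simps)
  also have "\<dots> \<le> mp_power A g i l + mp_power (mp_power A g) k l j"
    using mp_power_ge_walk[OF assms(1) l(1) sub(1)] Suc.IH[OF l(2) sub(2) len(2)] len(1)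
    by (intro add_mono) auto
  also have "\<dots> \<le> mp_power (mp_power A g) (Suc k) i j" using mp_mult_ge by simp
  finally show ?case by simp
qed

lemma mp_power_power_walk:
  assumes "max_plus_matrix A" "mp_power (mp_power A g) k i j \<noteq> -\<infinity>"
  obtains W where "walk i W j" "set W \<subseteq> edges A" "length W = g * k"
    "mp_power (mp_power A g) k i j = ereal (sum_list (map (entry A) W))"
proof -
  have mg: "max_plus_matrix (mp_power A g)" using assms(1) by (rule max_plus_power)
  have "\<exists>W. walk i W j \<and> set W \<subseteq> edges A \<and> length W = g * k \<and>
    mp_power (mp_power A g) k i j = ereal (sum_list (map (entry A) W))" using assms(2)
  proof (induction k arbitrary: i)
    case 0
    then show ?case by (intro exI[of _ "[]"]) (auto simp: mp_one_def zero_ereal_def split: if_splits)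
  next
    case (Suc k)
    obtain l where l: "mp_power (mp_power A g) (Suc k) i j = mp_power A g i l + mp_power (mp_power A g) k l j"
      using mp_mult_attained[of "mp_power A g" "mp_power (mp_power A g) k" i j] by auto
    have "mp_power A g i l \<noteq> \<infinity>" "mp_power (mp_power A g) k l j \<noteq> \<infinity>"
      using mg max_plus_power[OF mg] by (auto simp: max_plus_matrix_def)
    then have n: "mp_power A g i l \<noteq> -\<infinity>" "mp_power (mp_power A g) k l j \<noteq> -\<infinity>"
      using l Suc.prems by auto
    obtain W where W: "walk l W j" "set W \<subseteq> edges A" "length W = g * k"
      "mp_power (mp_power A g) k l j = ereal (sum_list (map (entry A) W))"
      using Suc.IH[OF n(2)] by blast
    obtain V where "walk i V l" "set V \<subseteq> edges A" "length V = g"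
      "mp_power A g i l = ereal (sum_list (map (entry A) V))"
      using mp_power_walk[OF assms(1) n(1)] by blast
    then show ?case using l W by (intro exI[of _ "V @ W"]) (auto simp: walk_append)
  qed
  then show thesis using that by blast
qed

section \<open>The critical graph\<close>

lemma wf_cycles_subgraph: "wf_digraph (cycles_subgraph A P)"
  by unfold_locales (auto simp: cycles_subgraph_def)

lemma scc_walk:
  assumes "wf_digraph G" "tail G = fst" "head G = snd"
    and H: "H \<in> pre_digraph.sccs G" and "u \<in> verts H" "v \<in> verts H"
  shows "\<exists>p. walk u p v \<and> set p \<subseteq> arcs G"
proof -
  interpret wf_digraph G by fact
  have "verts H \<in> sccs_verts" using H in_sccs_vertsI_sccs by blast
  then have "u \<rightarrow>\<^sup>*\<^bsub>G\<^esub> v" using assms(5,6) in_sccs_verts_conv_reachable by blast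
  then show ?thesis using reachable_awalk awalk_iff_walk[OF assms(2,3)] by metis
qed

lemma in_some_scc:
  assumes "wf_digraph G" "v \<in> verts G"
  shows "\<exists>H\<in>pre_digraph.sccs G. v \<in> verts H"
proof -
  interpret wf_digraph G by fact
  have "scc_of v \<in> sccs_verts" using assms(2) by (rule scc_of_in_sccs_verts)
  then show ?thesis using in_scc_of_self[OF assms(2)] sccs_verts_conv by auto
qed

lemma scc_nonempty: "H \<in> pre_digraph.sccs G \<Longrightarrow> verts H \<noteq> {} \<and> verts H \<subseteq> verts G"
  by (auto simp: pre_digraph.sccs_def strongly_connected_def induced_subgraph_def subgraph_def)

locale max_plus_setting =
  fixes A :: "'n::finite mp_matrix" and lam :: real
  assumes max_plus: "max_plus_matrix A" and lam: "max_cycle_mean A = ereal lam"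
begin

definition nw :: "'n \<times> 'n \<Rightarrow> real" where "nw e = entry A e - lam"

abbreviation wt :: "('n \<times> 'n) list \<Rightarrow> real" where "wt p \<equiv> sum_list (map nw p)"

definition crit :: "('n \<times> 'n) list \<Rightarrow> bool" where
  "crit Z \<longleftrightarrow> is_cyc Z \<and> set Z \<subseteq> edges A \<and> wt Z = 0"

abbreviation critical_nodes :: "'n set" where "critical_nodes \<equiv> verts (critical_graph A)"
abbreviation critical_arcs :: "('n \<times> 'n) set" where "critical_arcs \<equiv> arcs (critical_graph A)"

lemma wt_eq: "wt p = sum_list (map (entry A) p) - lam * real (length p)"
  by (induction p) (auto simp: nw_def algebra_simps)

lemma wt_eq_mean: "Z \<noteq> [] \<Longrightarrow> wt Z = (mean A Z - lam) * real (length Z)"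
  by (simp add: wt_eq mean_eq field_simps)

lemma mean_le_lam: "mp_cycle A Z \<Longrightarrow> mean A Z \<le> lam"
proof -
  assume "mp_cycle A Z"
  moreover obtain l where "max_cycle_mean A = ereal l" "\<And>Z. mp_cycle A Z \<Longrightarrow> mean A Z \<le> l"
    using max_cycle_mean_real[of A] lam by auto
  ultimately show ?thesis using lam by auto
qed

lemma cycle_wt_le_0: "is_cyc z \<Longrightarrow> set z \<subseteq> edges A \<Longrightarrow> wt z \<le> 0"
proof -
  assume z: "is_cyc z" "set z \<subseteq> edges A"
  then have "mean A z - lam \<le> 0" using mean_le_lam[of z] by (simp add: mp_cycle_iff)
  moreover have "z \<noteq> []" using z by (simp add: is_cyc_def)
  ultimately show "wt z \<le> 0" unfolding wt_eq_mean[OF \<open>z \<noteq> []\<close>] by (simp add: mult_nonpos_nonneg)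
qed

lemma crit_iff: "mp_cycle A Z \<and> ereal (mean A Z) = max_cycle_mean A \<longleftrightarrow> crit Z"
  using wt_eq_mean[of Z] by (auto simp: crit_def mp_cycle_iff lam is_cyc_def)

lemma ex_crit: "\<exists>Z. crit Z"
proof -
  obtain l Z where "max_cycle_mean A = ereal l" "mp_cycle A Z \<and> mean A Z = l"
    using max_cycle_mean_real[of A] lam by auto
  then show ?thesis using crit_iff by auto
qed

lemma critical_graph_simps:
  "critical_arcs = {e. \<exists>Z. crit Z \<and> e \<in> set Z}"
  "critical_nodes = {i. \<exists>Z. crit Z \<and> i \<in> snd ` set Z}"
  "tail (critical_graph A) = fst" "head (critical_graph A) = snd"
proof -
  have "fst ` set Z \<union> snd ` set Z = snd ` set Z" if "crit Z" for Z
  proof -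
    obtain u where "walk u Z u" "Z \<noteq> []" using \<open>crit Z\<close> by (auto simp: crit_def is_cyc_def)
    from closed_walk_nodes[OF this] show ?thesis by simp
  qed
  then have "{i. \<exists>Z. crit Z \<and> i \<in> snd ` set Z} = {i. \<exists>Z. crit Z \<and> i \<in> fst ` set Z \<union> snd ` set Z}"
    by blast
  then show "critical_nodes = {i. \<exists>Z. crit Z \<and> i \<in> snd ` set Z}"
    by (simp add: critical_graph_def cycles_subgraph_def crit_iff[symmetric] conj_assoc)
  show "critical_arcs = {e. \<exists>Z. crit Z \<and> e \<in> set Z}"
    by (simp add: critical_graph_def cycles_subgraph_def crit_iff[symmetric] conj_assoc)
qed (auto simp: critical_graph_def cycles_subgraph_def)

lemma critical_arcs_subset: "critical_arcs \<subseteq> edges A"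
  by (auto simp: critical_graph_simps crit_def)

lemma critical_arc_nodes: "e \<in> critical_arcs \<Longrightarrow> fst e \<in> critical_nodes \<and> snd e \<in> critical_nodes"
proof -
  assume "e \<in> critical_arcs"
  then obtain Z where Z: "crit Z" "e \<in> set Z" using critical_graph_simps by auto
  then obtain z where "walk z Z z" "Z \<noteq> []" by (auto simp: crit_def is_cyc_def)
  then have "fst ` set Z = snd ` set Z" by (rule closed_walk_nodes)
  then have "fst e \<in> snd ` set Z" "snd e \<in> snd ` set Z" using Z(2) by auto
  then show ?thesis unfolding critical_graph_simps(2) mem_Collect_eq
    by (intro conjI exI[of _ Z] Z(1))
qed

lemma critical_walk_end:
  "walk k p l \<Longrightarrow> set p \<subseteq> critical_arcs \<Longrightarrow> k \<in> critical_nodes \<Longrightarrow> l \<in> critical_nodes"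
proof (induction p arbitrary: k)
  case (Cons e p)
  then show ?case using critical_arc_nodes[of e] Cons.IH[of "snd e"] by auto
qed simp

lemma crit_rotate:
  assumes "k \<in> critical_nodes"
  obtains Z Z' where "crit Z" "k \<in> snd ` set Z" "walk k Z' k" "mset Z' = mset Z" "set Z' \<subseteq> critical_arcs"
    "Z' \<noteq> []" "wt Z' = 0"
proof -
  obtain Z where Z: "crit Z" "k \<in> snd ` set Z" using assms critical_graph_simps by auto
  then obtain Z' where Z': "walk k Z' k" "mset Z' = mset Z"
    using is_cyc_rotate[of Z k] by (auto simp: crit_def)
  have "set Z' = set Z" using Z'(2) by (metis set_mset_mset)
  moreover have "set Z \<subseteq> critical_arcs" using Z(1) critical_graph_simps by auto
  moreover have "Z \<noteq> []" "wt Z = 0" using Z by (auto simp: crit_def)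
  ultimately show thesis using that[OF Z Z'] sum_list_mset_eq[OF Z'(2), of nw] by fastforce
qed

text \<open>Each critical arc lies on a cycle of weight 0, whose other arcs lead back from its head
  to its tail with the opposite weight.\<close>

lemma critical_reverse:
  "walk u Q v \<Longrightarrow> set Q \<subseteq> critical_arcs \<Longrightarrow> \<exists>R. walk v R u \<and> set R \<subseteq> critical_arcs \<and> wt R = - wt Q"
proof (induction Q arbitrary: u)
  case Nil
  then show ?case by (intro exI[of _ "[]"]) auto
next
  case (Cons e Q)
  obtain R where R: "walk v R (snd e)" "set R \<subseteq> critical_arcs" "wt R = - wt Q"
    using Cons.IH[of "snd e"] Cons.prems by auto
  obtain Z where Z: "crit Z" "e \<in> set Z" using Cons.prems critical_graph_simps by auto
  obtain a b where ab: "Z = a @ e # b" using Z(2) by (meson split_list)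
  obtain z where "walk z Z z" using Z by (auto simp: crit_def is_cyc_def)
  then have "walk (snd e) (b @ a) (fst e)" using ab by (auto simp: walk_append)
  moreover have "wt (b @ a) = - nw e" using Z(1) ab by (auto simp: crit_def)
  moreover have "set (b @ a) \<subseteq> critical_arcs" using Z(1) ab by (auto simp: critical_graph_simps)
  ultimately show ?case using R Cons.prems
    by (intro exI[of _ "R @ b @ a"]) (auto simp: walk_append)
qed

lemma closed_wt_le_0: "walk u p u \<Longrightarrow> set p \<subseteq> edges A \<Longrightarrow> wt p \<le> 0"
  using closed_walk_weight_le_0[of u p "edges A" nw] cycle_wt_le_0 by blast

text \<open>The walk and its reversal are both closed, so both weights are at most 0, and they are
  opposite.\<close>

lemma critical_closed_wt: "walk u Q u \<Longrightarrow> set Q \<subseteq> critical_arcs \<Longrightarrow> wt Q = 0"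
proof -
  assume Q: "walk u Q u" "set Q \<subseteq> critical_arcs"
  then obtain R where R: "walk u R u" "set R \<subseteq> critical_arcs" "wt R = - wt Q"
    using critical_reverse by blast
  have "wt Q \<le> 0" "wt R \<le> 0"
    using closed_wt_le_0[OF Q(1)] closed_wt_le_0[OF R(1)] Q(2) R(2) critical_arcs_subset by auto
  then show "wt Q = 0" using R(3) by simp
qed

section \<open>Cyclicity of the critical graph\<close>

lemma fin_digraph_critical: "fin_digraph (critical_graph A)"
  using critical_arc_nodes by unfold_locales (auto simp: critical_graph_simps(3,4))

sublocale critical: fin_digraph "critical_graph A"
  by (rule fin_digraph_critical)

text \<open>A closed walk \<open>W\<close> elsewhere in the component of \<open>k\<close> is tied to
  \<open>k\<close> by connecting walks \<open>a\<close> and \<open>b\<close>: \<open>d\<close>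
  divides the lengths of \<open>a @ b\<close> and of \<open>a @ W @ b\<close>, hence that of
  \<open>W\<close>. So \<open>d\<close> divides the gcd of the component, which divides the
  lcm.\<close>

lemma scc_cyclicity_dvd_gamma:
  assumes k: "k \<in> critical_nodes" and d: "\<And>Q. walk k Q k \<Longrightarrow> set Q \<subseteq> critical_arcs \<Longrightarrow> d dvd length Q"
  shows "d dvd cyclicity (critical_graph A)"
proof -
  have "critical.scc_of k \<in> critical.sccs_verts" using k by (rule critical.scc_of_in_sccs_verts)
  then obtain H where H: "H \<in> critical.sccs" "verts H = critical.scc_of k"
    using critical.sccs_verts_conv by auto
  then have kH: "k \<in> verts H" using critical.in_scc_of_self[OF k] by simp
  have sub: "subgraph H (critical_graph A)"
    using critical.in_sccs_imp_induced[OF H(1)] by (rule induced_imp_subgraph)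
  then have th: "tail H = fst" "head H = snd" "arcs H \<subseteq> critical_arcs"
    using critical_graph_simps(3,4) by (auto simp: subgraph_def compatible_def)
  have "d dvd scc_cyclicity H" unfolding scc_cyclicity_def
  proof (rule Gcd_greatest)
    fix x assume "x \<in> {length W | W. \<exists>u. pre_digraph.awalk H u W u}"
    then obtain W u where W: "x = length W" "u \<in> verts H" "set W \<subseteq> critical_arcs" "walk u W u"
      using awalk_iff_walk[OF th(1,2)] th(3) by auto
    obtain a b where ab: "walk k a u" "set a \<subseteq> critical_arcs" "walk u b k" "set b \<subseteq> critical_arcs"
      using scc_walk[OF critical.wf_digraph_axioms critical_graph_simps(3,4) H(1)] kH W(2) by metis
    have "d dvd length (a @ b)" "d dvd length (a @ W @ b)"
      by (rule d; use ab W in \<open>auto simp: walk_append\<close>)+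
    then show "d dvd x" using W(1)
      by (metis add.assoc add.commute dvd_add_right_iff length_append)
  qed
  also have "\<dots> dvd cyclicity (critical_graph A)"
    unfolding cyclicity_def using H(1) by (intro dvd_Lcm) auto
  finally show ?thesis .
qed

text \<open>An lcm over an infinite set or one containing 0 would be 0. A component has cyclicity 0
  only if all its closed walks are empty, but every critical node lies on a nonempty closed critical
  walk, and this walk stays in the component.\<close>

lemma gamma_pos: "0 < cyclicity (critical_graph A)"
proof -
  have "finite critical.sccs"
    using critical.sccs_conv_sccs_verts critical.finite_sccs_verts by simp
  moreover have "scc_cyclicity H \<noteq> 0" if H: "H \<in> critical.sccs" for H
  proof
    assume z: "scc_cyclicity H = 0"
    have ind: "induced_subgraph H (critical_graph A)" using critical.in_sccs_imp_induced[OF H] .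
    then have th: "tail H = fst" "head H = snd" "verts H \<subseteq> critical_nodes"
      using critical_graph_simps(3,4) by (auto simp: induced_subgraph_def subgraph_def compatible_def)
    have S: "verts H \<in> critical.sccs_verts" using H critical.in_sccs_vertsI_sccs by blast
    then obtain v where v: "v \<in> verts H" using critical.in_sccs_verts_conv_reachable by auto
    then obtain Z' where Z': "walk v Z' v" "set Z' \<subseteq> critical_arcs" "Z' \<noteq> []"
      using crit_rotate th(3) by blast
    have node: "x \<in> verts H" if x: "x \<in> snd ` set Z'" for x
    proof -
      obtain p1 p2 where p: "Z' = p1 @ p2" "walk v p1 x" "walk x p2 v"
        using walk_split_node[OF Z'(1), of x] x by blast
      have "v \<rightarrow>\<^sup>*\<^bsub>critical_graph A\<^esub> x" "x \<rightarrow>\<^sup>*\<^bsub>critical_graph A\<^esub> v"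
        using p Z' v th(3) critical_walk_end[OF p(2)]
        by (auto intro!: critical.reachable_awalkI simp: awalk_iff_walk critical_graph_simps(3,4))
      then show ?thesis using S v critical.in_sccs_verts_conv_reachable by blast
    qed
    have "set Z' \<subseteq> arcs H"
    proof
      fix e assume e: "e \<in> set Z'"
      then have "snd e \<in> verts H" "fst e \<in> verts H"
        using node closed_walk_nodes[OF Z'(1,3)] by blast+
      then show "e \<in> arcs H" using ind e Z'(2)
        by (auto simp: induced_subgraph_def critical_graph_simps(3,4))
    qed
    then have "pre_digraph.awalk H v Z' v" using v Z' awalk_iff_walk[OF th(1,2)] by auto
    then have "length Z' \<in> {0}" using z unfolding scc_cyclicity_def Gcd_0_iff by blast
    then show False using Z'(3) by simp
  qed
  ultimately have "finite (scc_cyclicity ` critical.sccs)" "0 \<notin> scc_cyclicity ` critical.sccs"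
    by (blast, metis imageE)
  then have "Lcm (scc_cyclicity ` critical.sccs) \<noteq> 0" by (simp only: Lcm_0_iff not_False_eq_True)
  then show ?thesis unfolding cyclicity_def by (rule neq0_conv[THEN iffD1])
qed

text \<open>Modulo \<open>l\<close>, the lengths of closed critical walks at \<open>k\<close> form a
  subgroup. Its least positive representative \<open>d\<close> divides the length of each such walk
  and hence the cyclicity, so all multiples of the cyclicity are attained.\<close>

lemma critical_residue:
  assumes k: "k \<in> critical_nodes" and l: "0 < l" and L: "walk k L k" "set L \<subseteq> critical_arcs" "length L = l"
    and m: "cyclicity (critical_graph A) dvd m"
  obtains Q where "walk k Q k" "set Q \<subseteq> critical_arcs" "[length Q = m] (mod l)"
proof -
  define ok where "ok x \<longleftrightarrow> (\<exists>Q. walk k Q k \<and> set Q \<subseteq> critical_arcs \<and> [length Q = x] (mod l))" for x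
  have add: "ok (x + y)" if xy: "ok x" "ok y" for x y
  proof -
    obtain P Q where "walk k P k" "set P \<subseteq> critical_arcs" "[length P = x] (mod l)"
      "walk k Q k" "set Q \<subseteq> critical_arcs" "[length Q = y] (mod l)"
      using xy unfolding ok_def by blast
    then show ?thesis unfolding ok_def
      by (intro exI[of _ "P @ Q"]) (auto intro: walk_appendI cong_add)
  qed
  have mult: "ok (c * x)" if "ok x" for c x
  proof (induction c)
    case 0
    then show ?case unfolding ok_def by (intro exI[of _ "[]"]) auto
  qed (use add that in auto)
  have cong: "ok y" if "ok x" "[x = y] (mod l)" for x y
    using that unfolding ok_def by (meson cong_trans)
  have "ok l" using L unfolding ok_def by auto
  define d where "d = (LEAST x. 0 < x \<and> ok x)"
  have d: "0 < d" "ok d" using LeastI[of "\<lambda>x. 0 < x \<and> ok x" l] l \<open>ok l\<close> by (auto simp: d_def)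
  have least: "d \<le> x" if "0 < x" "ok x" for x unfolding d_def by (rule Least_le) (use that in auto)
  have dvd: "d dvd x" if x: "ok x" for x
  proof (rule ccontr)
    assume "\<not> d dvd x"
    then have r: "0 < x mod d" by (simp add: dvd_eq_mod_eq_0)
    \<comment> \<open>Walks can only be concatenated, so subtraction modulo \<open>l\<close> is
      replaced by adding \<open>l - 1\<close> times the same amount.\<close>
    have "x + (l - 1) * (x div d) * d = x mod d + l * (x div d * d)"
    proof -
      obtain l' where l': "l = Suc l'" using l by (cases l) auto
      have "x = x mod d + x div d * d" by simp
      then show ?thesis unfolding l' by (simp add: algebra_simps)
    qed
    moreover have "ok (x + (l - 1) * (x div d) * d)" using add[OF x mult[OF d(2)]] .
    ultimately have "ok (x mod d + l * (x div d * d))" by simp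
    then have "ok (x mod d)" by (rule cong) (simp add: cong_def)
    from least[OF r this] show False using mod_less_divisor[OF d(1), of x] by simp
  qed
  have "d dvd cyclicity (critical_graph A)"
  proof (rule scc_cyclicity_dvd_gamma[OF k])
    fix Q assume "walk k Q k" "set Q \<subseteq> critical_arcs"
    then have "ok (length Q)" unfolding ok_def by (intro exI[of _ Q]) simp
    then show "d dvd length Q" by (rule dvd)
  qed
  then have "d dvd m" using m by (rule dvd_trans)
  then obtain c where "m = c * d" by (metis dvd_def mult.commute)
  then have "ok m" using mult[OF d(2)] by simp
  then obtain Q where "walk k Q k" "set Q \<subseteq> critical_arcs" "[length Q = m] (mod l)"
    unfolding ok_def by blast
  then show thesis by (rule that)
qed

subsection \<open>CSR terms\<close>

abbreviation gamma :: nat where "gamma \<equiv> cyclicity (critical_graph A)"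

lemma edges_normalized: "edges (normalized A) = edges A"
proof -
  have "normalized A i j \<noteq> -\<infinity> \<longleftrightarrow> A i j \<noteq> -\<infinity>" for i j
    by (cases "A i j") (auto simp: normalized_def lam)
  then show ?thesis by (simp add: edges_def)
qed

lemma max_plus_normalized: "max_plus_matrix (normalized A)"
proof -
  have "normalized A i j \<noteq> \<infinity>" for i j
    using max_plus by (cases "A i j") (auto simp: normalized_def lam max_plus_matrix_def)
  then show ?thesis by (simp add: max_plus_matrix_def)
qed

lemma entry_normalized: "e \<in> edges A \<Longrightarrow> entry (normalized A) e = nw e"
  using entry_eq[OF max_plus, of e] by (subst entry_def) (simp add: nw_def normalized_def lam)

lemma wt_normalized: "set W \<subseteq> edges A \<Longrightarrow> sum_list (map (entry (normalized A)) W) = wt W"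
  using entry_normalized by (induction W) auto

lemma max_plus_S: "max_plus_matrix (csr_S A)"
  using max_plus_normalized by (auto simp: csr_S_def max_plus_matrix_def)

lemma edges_S: "edges (csr_S A) = critical_arcs"
  using critical_arcs_subset edges_normalized
  by (auto simp: csr_S_def edges_def)

lemma wt_S: "set W \<subseteq> critical_arcs \<Longrightarrow> sum_list (map (entry (csr_S A)) W) = wt W"
proof (induction W)
  case (Cons e W)
  then have "entry (csr_S A) e = entry (normalized A) e" by (simp add: entry_def csr_S_def)
  then show ?case using Cons entry_normalized[of e] critical_arcs_subset by auto
qed simp

lemma csr_M_ge:
  assumes "walk i W j" "set W \<subseteq> edges A" "gamma dvd length W"
  shows "ereal (wt W) \<le> csr_M A i j"
proof -
  obtain k where k: "length W = gamma * k" using assms(3) by blast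
  have "ereal (wt W) \<le> mp_power (mp_power (normalized A) gamma) k i j"
    using mp_power_power_ge[OF max_plus_normalized assms(1) _ k] assms(2)
    by (simp add: edges_normalized wt_normalized)
  also have "\<dots> \<le> csr_M A i j" unfolding csr_M_def mp_star_def by (rule SUP_upper) simp
  finally show ?thesis .
qed

lemma power_term_walk:
  assumes "mp_power (mp_power (normalized A) gamma) k i j \<noteq> -\<infinity>"
  obtains W where "walk i W j" "set W \<subseteq> edges A" "length W = gamma * k"
    "mp_power (mp_power (normalized A) gamma) k i j = ereal (wt W)"
  using mp_power_power_walk[OF max_plus_normalized assms] wt_normalized edges_normalized by metis

text \<open>Finiteness matters because \<open>-\<infinity> + \<infinity> = \<infinity>\<close> in \<^typ>\<open>ereal\<close>.\<close>

lemma csr_M_not_inf: "csr_M A i j \<noteq> \<infinity>"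
proof -
  have "csr_M A i j \<le> ereal (\<Sum>e\<in>UNIV. \<bar>nw e\<bar>)" unfolding csr_M_def mp_star_def
  proof (rule SUP_least)
    fix k
    show "mp_power (mp_power (normalized A) gamma) k i j \<le> ereal (\<Sum>e\<in>UNIV. \<bar>nw e\<bar>)"
    proof (cases "mp_power (mp_power (normalized A) gamma) k i j = -\<infinity>")
      case False
      then obtain W where W: "walk i W j" "set W \<subseteq> edges A"
        "mp_power (mp_power (normalized A) gamma) k i j = ereal (wt W)"
        using power_term_walk by metis
      then show ?thesis using walk_weight_bounded[OF W(1,2) cycle_wt_le_0] by simp
    qed simp
  qed
  then show ?thesis by auto
qed

text \<open>Moving \<open>c\<close> into the supremum reduces the claim to single walks. This
  exchange needs \<open>c \<noteq> -\<infinity>\<close>; for \<open>c = -\<infinity>\<close> the sum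
  is \<open>-\<infinity>\<close> because \<open>csr_M\<close> is never
  \<open>\<infinity>\<close>.\<close>

lemma csr_M_plus_le:
  fixes c :: ereal
  assumes "c \<noteq> \<infinity>"
    and "\<And>W. walk i W j \<Longrightarrow> set W \<subseteq> edges A \<Longrightarrow> gamma dvd length W \<Longrightarrow> ereal (wt W) + c \<le> x"
  shows "csr_M A i j + c \<le> x"
proof (cases "c = -\<infinity>")
  case True
  then show ?thesis using csr_M_not_inf[of i j] by (cases "csr_M A i j") auto
next
  case False
  have "csr_M A i j + c = (SUP k. mp_power (mp_power (normalized A) gamma) k i j + c)"
    unfolding csr_M_def mp_star_def by (rule SUP_ereal_add_left[symmetric]) (auto simp: False)
  also have "\<dots> \<le> x"
  proof (rule SUP_least)
    fix k
    show "mp_power (mp_power (normalized A) gamma) k i j + c \<le> x"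
    proof (cases "mp_power (mp_power (normalized A) gamma) k i j = -\<infinity>")
      case True
      then show ?thesis using assms(1) by (cases c) auto
    next
      case False
      then obtain W where "walk i W j" "set W \<subseteq> edges A" "length W = gamma * k"
        "mp_power (mp_power (normalized A) gamma) k i j = ereal (wt W)"
        using power_term_walk by metis
      then show ?thesis using assms(2) by simp
    qed
  qed
  finally show ?thesis .
qed

text \<open>A summand of the triple product is a supremum of weights of walks
  \<open>V @ Q @ R\<close>, where \<open>V\<close> and \<open>R\<close> have lengths divisible by
  \<open>gamma\<close> and \<open>Q\<close> is a critical walk of length \<open>t\<close>. Such a
  walk meets a critical node between \<open>V\<close> and \<open>Q\<close>.\<close>

lemma csr_le:
  assumes "\<And>p1 p2 k. walk i p1 k \<Longrightarrow> walk k p2 j \<Longrightarrow> k \<in> critical_nodes \<Longrightarrow> set (p1 @ p2) \<subseteq> edges A \<Longrightarrow>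
    [length (p1 @ p2) = t] (mod gamma) \<Longrightarrow> ereal (wt (p1 @ p2)) \<le> x"
  shows "csr A t i j \<le> x"
  unfolding csr_def
proof (rule mp_mult_le)
  fix l
  obtain k where k: "mp_mult (csr_C A) (mp_power (csr_S A) t) i l = csr_C A i k + mp_power (csr_S A) t k l"
    using mp_mult_attained by metis
  have S: "mp_power (csr_S A) t k l \<noteq> \<infinity>" using max_plus_power[OF max_plus_S] by (simp add: max_plus_matrix_def)
  have "csr_C A i k + mp_power (csr_S A) t k l + csr_R A l j \<le> x"
  proof (cases "k \<in> critical_nodes \<and> l \<in> critical_nodes \<and> mp_power (csr_S A) t k l \<noteq> -\<infinity>")
    case False
    then consider "k \<notin> critical_nodes" | "l \<notin> critical_nodes" | "mp_power (csr_S A) t k l = -\<infinity>" by blast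
    then have "csr_C A i k + mp_power (csr_S A) t k l + csr_R A l j = -\<infinity>"
      using S csr_M_not_inf[of i k] csr_M_not_inf[of l j] by cases (auto simp: csr_C_def csr_R_def)
    then show ?thesis by (simp only: ereal_less_eq)
  next
    case True
    then obtain Q where Q: "walk k Q l" "set Q \<subseteq> critical_arcs" "length Q = t"
      "mp_power (csr_S A) t k l = ereal (wt Q)"
      using mp_power_walk[OF max_plus_S] wt_S edges_S by metis
    have QE: "set Q \<subseteq> edges A" using Q(2) critical_arcs_subset by blast
    have "csr_M A i k + (ereal (wt Q) + csr_M A l j) \<le> x"
    proof (rule csr_M_plus_le)
      show "ereal (wt Q) + csr_M A l j \<noteq> \<infinity>" using csr_M_not_inf by simp
      fix V assume V: "walk i V k" "set V \<subseteq> edges A" "gamma dvd length V"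
      have "csr_M A l j + (ereal (wt Q) + ereal (wt V)) \<le> x"
      proof (rule csr_M_plus_le)
        fix R assume R: "walk l R j" "set R \<subseteq> edges A" "gamma dvd length R"
        have "[length V + (length Q + length R) = 0 + (t + 0)] (mod gamma)"
          using V(3) R(3) Q(3) by (intro cong_add) (auto simp: cong_0_iff)
        then have "ereal (wt (V @ (Q @ R))) \<le> x"
          using assms[OF V(1), of "Q @ R"] Q(1) R V(2) QE True by (auto simp: walk_append)
        then show "ereal (wt R) + (ereal (wt Q) + ereal (wt V)) \<le> x" by (simp add: ac_simps)
      qed simp
      then show "ereal (wt V) + (ereal (wt Q) + csr_M A l j) \<le> x" by (simp add: ac_simps)
    qed
    then show ?thesis using True Q(4) by (simp add: csr_C_def csr_R_def ac_simps)
  qed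
  then show "mp_mult (csr_C A) (mp_power (csr_S A) t) i l + csr_R A l j \<le> x" by (simp add: k)
qed

lemma csr_ge:
  assumes p: "walk i p1 k" "walk k p2 j" "k \<in> critical_nodes" "set (p1 @ p2) \<subseteq> edges A"
    and c: "[length (p1 @ p2) = t] (mod gamma)"
  shows "ereal (wt (p1 @ p2)) \<le> csr A t i j"
proof -
  obtain Z where Z: "walk k Z k" "set Z \<subseteq> critical_arcs" "Z \<noteq> []" using crit_rotate[OF p(3)] by metis
  \<comment> \<open>With \<open>r\<close> more arcs, \<open>p1\<close> has length
    \<open>gamma * length p1\<close>. The number \<open>m\<close> of copies of \<open>Z\<close>
    makes the detour a multiple of \<open>gamma\<close> and long enough for the pieces of lengths
    \<open>r\<close> and \<open>t\<close>.\<close>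
  define r where "r = (gamma - 1) * length p1"
  define m where "m = gamma * (r + t)"
  \<comment> \<open>A long critical detour through \<open>k\<close>, cut into a piece \<open>o1\<close> that completes \<open>p1\<close> to a multiple
    of \<open>gamma\<close>, a piece \<open>o2\<close> of length \<open>t\<close>, and the rest.\<close>
  define O' where "O' = concat (replicate m Z)"
  have lO: "length O' = m * length Z" by (simp add: O'_def length_concat_replicate)
  have "r + t \<le> m * length Z"
    using gamma_pos Z(3) by (simp add: m_def Suc_leI mult.assoc)
  define o1 where "o1 = take r O'"
  define o2 where "o2 = take t (drop r O')"
  define o3 where "o3 = drop t (drop r O')"
  have O': "O' = o1 @ o2 @ o3" by (simp only: o1_def o2_def o3_def append_take_drop_id)
  have len: "length o1 = r" "length o2 = t" 
    using \<open>r + t \<le> m * length Z\<close> lO by (simp_all add: o1_def o2_def)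
  have "walk k O' k" unfolding O'_def by (rule walk_replicate[OF Z(1)])
  then obtain k1 k2 where k: "walk k o1 k1" "walk k1 o2 k2" "walk k2 o3 k"
    unfolding O' by (auto simp: walk_append)
  have crit: "set o1 \<subseteq> critical_arcs" "set o2 \<subseteq> critical_arcs" "set o3 \<subseteq> critical_arcs"
    using set_concat_replicate[of m Z] Z(2) O' unfolding O'_def by auto
  have nodes: "k1 \<in> critical_nodes" "k2 \<in> critical_nodes"
    using critical_walk_end[OF k(1) crit(1) p(3)] critical_walk_end[OF k(2) crit(2)] by auto
  have l1: "length (p1 @ o1) = gamma * length p1"
    using gamma_pos len(1) by (cases gamma) (auto simp: r_def)
  have l3: "gamma dvd length (o3 @ p2)"
  proof -
    have eq: "gamma * length p1 + t + length (o3 @ p2) = length O' + length (p1 @ p2)"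
      using l1 len(2) O' by simp
    have "[length O' = 0] (mod gamma)" by (simp add: lO m_def cong_0_iff)
    then have "[gamma * length p1 + t + length (o3 @ p2) = 0 + t] (mod gamma)"
      unfolding eq using c by (rule cong_add)
    moreover have "[gamma * length p1 + t + length (o3 @ p2) = 0 + t + length (o3 @ p2)] (mod gamma)"
      by (intro cong_add) (auto simp: cong_0_iff)
    ultimately have "[t + length (o3 @ p2) = t + 0] (mod gamma)"
      by (metis add_0 add.right_neutral cong_sym cong_trans)
    then show ?thesis by (simp only: cong_add_lcancel_nat cong_0_iff)
  qed
  have M1: "ereal (wt (p1 @ o1)) \<le> csr_C A i k1"
    using csr_M_ge[of i "p1 @ o1" k1] p k crit critical_arcs_subset l1 nodes
    by (auto simp: csr_C_def intro!: csr_M_ge walk_appendI)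
  have M3: "ereal (wt (o3 @ p2)) \<le> csr_R A k2 j"
    using csr_M_ge[of k2 "o3 @ p2" j] p k crit critical_arcs_subset l3 nodes
    by (auto simp: csr_R_def intro!: walk_appendI)
  have S: "ereal (wt o2) \<le> mp_power (csr_S A) t k1 k2"
    using mp_power_ge_walk[OF max_plus_S k(2)] crit(2) len(2) by (simp add: edges_S wt_S)
  have "wt (o1 @ o2 @ o3) = 0"
    using critical_closed_wt[of k O'] \<open>walk k O' k\<close> crit by (simp add: O')
  then have "ereal (wt (p1 @ p2)) = ereal (wt (p1 @ o1)) + ereal (wt o2) + ereal (wt (o3 @ p2))"
    by simp
  also have "\<dots> \<le> csr_C A i k1 + mp_power (csr_S A) t k1 k2 + csr_R A k2 j"
    by (intro add_mono M1 M3 S)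
  also have "\<dots> \<le> mp_mult (csr_C A) (mp_power (csr_S A) t) i k2 + csr_R A k2 j"
    by (intro add_mono mp_mult_ge order_refl)
  also have "\<dots> \<le> csr A t i j" unfolding csr_def by (rule mp_mult_ge)
  finally show ?thesis .
qed

subsection \<open>Cycle thresholds\<close>

text \<open>Membership in a component of a threshold graph is replaced by chains of single cycles,
  because heaviest walks are moved one cycle at a time.\<close>

definition linked_arcs :: "real \<Rightarrow> ('n \<times> 'n) set" where
  "linked_arcs \<mu> = {(x, y). \<exists>Z. mp_cycle A Z \<and> \<mu> \<le> mean A Z \<and> x \<in> snd ` set Z \<and> y \<in> snd ` set Z}"

definition linked :: "real \<Rightarrow> 'n \<Rightarrow> bool" where
  "linked \<mu> v \<longleftrightarrow> (\<exists>c\<in>critical_nodes. (v, c) \<in> (linked_arcs \<mu>)\<^sup>*)"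

lemma cycle_nodes: "mp_cycle A Z \<Longrightarrow> fst ` set Z = snd ` set Z"
proof -
  assume "mp_cycle A Z"
  then obtain z where "walk z Z z" "Z \<noteq> []" by (auto simp: mp_cycle_iff is_cyc_def)
  then show ?thesis by (rule closed_walk_nodes)
qed

lemma walk_linked:
  assumes "walk u p v" "\<And>e. e \<in> set p \<Longrightarrow> \<exists>Z. mp_cycle A Z \<and> \<mu> \<le> mean A Z \<and> e \<in> set Z"
  shows "(u, v) \<in> (linked_arcs \<mu>)\<^sup>*"
  using assms
proof (induction p arbitrary: u)
  case (Cons e p)
  obtain Z where Z: "mp_cycle A Z" "\<mu> \<le> mean A Z" "e \<in> set Z" using Cons.prems(2)[of e] by auto
  then have "snd e \<in> snd ` set Z" "fst e \<in> snd ` set Z" using cycle_nodes[OF Z(1)] by auto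
  then have "(fst e, snd e) \<in> linked_arcs \<mu>" using Z unfolding linked_arcs_def by blast
  moreover have "(snd e, v) \<in> (linked_arcs \<mu>)\<^sup>*" using Cons by auto
  ultimately have "(fst e, v) \<in> (linked_arcs \<mu>)\<^sup>*" by (rule converse_rtrancl_into_rtrancl)
  then show ?case using Cons.prems(1) by simp
qed simp

lemma ct_subgraph_real:
  "wf_digraph (ct_subgraph A (ereal \<mu>))" "tail (ct_subgraph A (ereal \<mu>)) = fst"
  "head (ct_subgraph A (ereal \<mu>)) = snd"
  "arcs (ct_subgraph A (ereal \<mu>)) = {e. \<exists>Z. mp_cycle A Z \<and> \<mu> \<le> mean A Z \<and> e \<in> set Z}"
  "verts (ct_subgraph A (ereal \<mu>)) =
    {i. \<exists>Z. mp_cycle A Z \<and> \<mu> \<le> mean A Z \<and> i \<in> fst ` set Z \<union> snd ` set Z}"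
  by (simp_all add: ct_subgraph_def wf_cycles_subgraph) (simp_all add: cycles_subgraph_def)

lemma scc_linked:
  assumes "H \<in> pre_digraph.sccs (ct_subgraph A (ereal \<mu>))" "v \<in> verts H" "c \<in> verts H" "c \<in> critical_nodes"
  shows "linked \<mu> v"
proof -
  obtain p where p: "walk v p c" "set p \<subseteq> arcs (ct_subgraph A (ereal \<mu>))"
    using scc_walk[OF ct_subgraph_real(1-3) assms(1-3)] by blast
  have "(v, c) \<in> (linked_arcs \<mu>)\<^sup>*"
    by (rule walk_linked[OF p(1)]) (use p(2) ct_subgraph_real(4) in auto)
  then show ?thesis using assms(4) by (auto simp: linked_def)
qed

text \<open>With its own mean as threshold, \<open>Z\<close> lies in the threshold graph. Since that
  threshold is not admissible, the component of \<open>x\<close> contains a critical component, and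
  a walk to it inside the threshold graph gives the chain.\<close>

lemma linked_if_not_admissible:
  assumes "\<not> ct_admissible A (mean A Z)" "mp_cycle A Z" "x \<in> snd ` set Z"
  shows "linked (mean A Z) x"
proof -
  let ?G = "ct_subgraph A (ereal (mean A Z))"
  have "x \<in> verts ?G" using assms(2,3) by (auto simp: ct_subgraph_real(5))
  then obtain H where H: "H \<in> pre_digraph.sccs ?G" "x \<in> verts H"
    using in_some_scc[OF ct_subgraph_real(1)] by blast
  then obtain K where K: "K \<in> critical.sccs" "subgraph K H"
    using assms(1) mean_le_lam[OF assms(2)] by (auto simp: ct_admissible_def lam)
  then obtain c where "c \<in> verts K" "c \<in> critical_nodes" using scc_nonempty[OF K(1)] by blast
  moreover have "verts K \<subseteq> verts H" using K(2) by (rule subgraph_imp_subverts)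
  ultimately show ?thesis using scc_linked[OF H(1,2)] by blast
qed

text \<open>Raising a threshold to the next cycle mean does not change the threshold graph. Hence
  each admissible value is below an admissible cycle mean, and as there are finitely many of these,
  \<open>GREATEST\<close> is attained.\<close>

lemma mu_ct_greatest:
  assumes ex: "\<exists>\<mu>. ct_admissible A \<mu>"
  obtains g where "mu_ct A = ereal g" "\<And>\<mu>. ct_admissible A \<mu> \<Longrightarrow> \<mu> \<le> g"
proof -
  define S where "S = {mean A Z | Z. mp_cycle A Z}"
  have fin: "finite S" unfolding S_def by (rule finite_means)
  have up: "\<exists>m\<in>S. \<mu> \<le> m \<and> ct_admissible A m" if adm: "ct_admissible A \<mu>" for \<mu>
  proof -
    have le: "\<mu> \<le> lam" using adm by (simp add: ct_admissible_def lam)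
    obtain Z0 where "crit Z0" using ex_crit by blast
    then have "lam \<in> S" using crit_iff[of Z0] lam by (auto simp: S_def)
    define m where "m = Min {x \<in> S. \<mu> \<le> x}"
    have "m \<in> {x \<in> S. \<mu> \<le> x}"
      unfolding m_def using fin \<open>lam \<in> S\<close> le by (intro Min_in) auto
    then have m: "m \<in> S" "\<mu> \<le> m" by auto
    have least: "m \<le> x" if "x \<in> S" "\<mu> \<le> x" for x
      unfolding m_def using fin that by (intro Min_le) auto
    then have "m \<le> lam" using \<open>lam \<in> S\<close> le by blast
    have "mp_cycle A Z \<and> ereal \<mu> \<le> ereal (mean A Z) \<longleftrightarrow> mp_cycle A Z \<and> ereal m \<le> ereal (mean A Z)" for Z
      using least[of "mean A Z"] m(2) by (auto simp: S_def)
    then have "cycles_subgraph A (\<lambda>Z. ereal (mean A Z) \<ge> ereal \<mu>) = cycles_subgraph A (\<lambda>Z. ereal (mean A Z) \<ge> ereal m)"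
      unfolding cycles_subgraph_def conj_assoc[symmetric] by simp
    then have "ct_subgraph A (ereal \<mu>) = ct_subgraph A (ereal m)"
      by (simp add: ct_subgraph_def)
    then have "ct_admissible A m" using adm \<open>m \<le> lam\<close> by (simp add: ct_admissible_def lam)
    then show ?thesis using m by blast
  qed
  define g where "g = Max {m \<in> S. ct_admissible A m}"
  have g: "g \<in> {m \<in> S. ct_admissible A m}"
    unfolding g_def using fin ex up by (intro Max_in) auto
  have ub: "\<mu> \<le> g" if adm: "ct_admissible A \<mu>" for \<mu>
  proof -
    obtain m where "m \<in> S" "\<mu> \<le> m" "ct_admissible A m" using up[OF adm] by blast
    moreover then have "m \<le> g" unfolding g_def using fin by (intro Max_ge) auto
    ultimately show ?thesis by simp
  qed
  have "(GREATEST \<mu>. ct_admissible A \<mu>) = g"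
    using g ub by (intro Greatest_equality) auto
  then have "mu_ct A = ereal g" using ex by (simp add: mu_ct_def)
  then show thesis using ub that by blast
qed

text \<open>If admissible thresholds exist, \<open>\<mu>\<close> is the greatest one, so larger
  cycle means are not admissible. Otherwise the threshold graph is the whole digraph and the least
  cycle mean serves: an arc on a walk inside a component can be completed to a closed walk and so
  lies on a cycle.\<close>

lemma G_ct_linked:
  assumes "v \<in> verts (G_ct A)"
  obtains \<mu> where "linked \<mu> v"
    "\<And>Z x. mp_cycle A Z \<Longrightarrow> \<mu> < mean A Z \<Longrightarrow> x \<in> snd ` set Z \<Longrightarrow> linked (mean A Z) x"
proof -
  obtain H c where H: "H \<in> pre_digraph.sccs (ct_subgraph A (mu_ct A))" "v \<in> verts H"
    "c \<in> verts H" "c \<in> critical_nodes"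
    using assms by (auto simp: G_ct_def pre_digraph.Union_def)
  show thesis
  proof (cases "\<exists>\<mu>. ct_admissible A \<mu>")
    case True
    then obtain g where g: "mu_ct A = ereal g" "\<And>\<mu>. ct_admissible A \<mu> \<Longrightarrow> \<mu> \<le> g"
      using mu_ct_greatest by blast
    show thesis
    proof (rule that[of g])
      show "linked g v" using scc_linked H unfolding g(1) by blast
      show "linked (mean A Z) x" if "mp_cycle A Z" "g < mean A Z" "x \<in> snd ` set Z" for Z x
        using linked_if_not_admissible[OF _ that(1,3)] g(2)[of "mean A Z"] that(2) by fastforce
    qed
  next
    case False
    then have D: "ct_subgraph A (mu_ct A) = mp_digraph A" by (simp add: mu_ct_def ct_subgraph_def)
    have wf: "wf_digraph (mp_digraph A)" by unfold_locales auto
    obtain p q where pq: "walk v p c" "walk c q v" "set p \<subseteq> edges A" "set q \<subseteq> edges A"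
      using scc_walk[OF wf _ _ H(1)[unfolded D]] H(2,3) by (metis mp_digraph_simps(2-4))
    define \<mu> where "\<mu> = Min {mean A Z | Z. mp_cycle A Z}"
    have \<mu>: "\<mu> \<le> mean A Z" if "mp_cycle A Z" for Z
      unfolding \<mu>_def using finite_means that by (intro Min_le) auto
    show thesis
    proof (rule that[of \<mu>])
      have "\<exists>Z. mp_cycle A Z \<and> \<mu> \<le> mean A Z \<and> e \<in> set Z" if e: "e \<in> set p" for e
      proof -
        have "walk v (p @ q) v" by (rule walk_appendI[OF pq(1,2)])
        then obtain Z where "is_cyc Z" "e \<in> set Z" "set Z \<subseteq> set (p @ q)"
          using closed_walk_arc_on_cycle[of v "p @ q" e] e by auto
        moreover then have "mp_cycle A Z" using pq by (auto simp: mp_cycle_iff)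
        ultimately show ?thesis using \<mu> by blast
      qed
      then show "linked \<mu> v" using walk_linked[OF pq(1)] H(4) by (auto simp: linked_def)
      show "linked (mean A Z) x" if "mp_cycle A Z" "\<mu> < mean A Z" "x \<in> snd ` set Z" for Z x
        using linked_if_not_admissible[OF _ that(1,3)] False by blast
    qed
  qed
qed

subsection \<open>The two inequalities\<close>

definition shortenable :: "('n \<times> 'n) list \<Rightarrow> 'n \<Rightarrow> ('n \<times> 'n) list \<Rightarrow> 'n \<Rightarrow> bool" where
  "shortenable Z i W j \<longleftrightarrow> (\<exists>V. walk i V j \<and> set V \<subseteq> edges A \<and> visited i V \<inter> snd ` set Z \<noteq> {} \<and>
      [length V = length W] (mod length Z) \<and> length V < length W \<and> wt W \<le> wt V)"

text \<open>This isolates what the lower inequality requires of \<open>T\<close>. The summand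
  \<open>length Z\<close> is affordable because a walk with fewer than \<open>T + length Z\<close>
  arcs, congruent to some \<open>t \<ge> T\<close> modulo \<open>length Z\<close>, has at most
  \<open>t\<close> arcs.\<close>

definition shortens :: "nat \<Rightarrow> bool" where
  "shortens T \<longleftrightarrow> (\<forall>Z i W j. crit Z \<longrightarrow> walk i W j \<longrightarrow> set W \<subseteq> edges A \<longrightarrow>
    visited i W \<inter> snd ` set Z \<noteq> {} \<longrightarrow> T + length Z \<le> length W \<longrightarrow>
    shortenable Z i W j)"

lemma power_lower: "walk i V j \<Longrightarrow> set V \<subseteq> edges A \<Longrightarrow>
    ereal (wt V + lam * real (length V)) \<le> mp_power A (length V) i j"
  using mp_power_ge_walk[OF max_plus, of i V j] by (simp add: wt_eq)

lemma csr_le_power: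
  assumes T: "shortens T" "T \<le> t"
  shows "ereal (real t) * max_cycle_mean A + csr A t i j \<le> mp_power A t i j"
proof -
  have "csr A t i j \<le> mp_power A t i j - ereal (real t * lam)"
  proof (rule csr_le)
    fix p1 p2 k
    assume p: "walk i p1 k" "walk k p2 j" "k \<in> critical_nodes" "set (p1 @ p2) \<subseteq> edges A"
      "[length (p1 @ p2) = t] (mod gamma)"
    obtain Z Z' where Z: "crit Z" "k \<in> snd ` set Z" "walk k Z' k" "mset Z' = mset Z"
      "set Z' \<subseteq> critical_arcs" "Z' \<noteq> []"
      using crit_rotate[OF p(3)] by metis
    define l where "l = length Z"
    have lZ': "length Z' = l" using Z(4) unfolding l_def by (metis size_mset)
    have l: "0 < l" using lZ' Z(6) by auto
    define n where "n = length (p1 @ p2)"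
    \<comment> \<open>As \<open>m + n = t + n * (l * gamma)\<close>, inserting \<open>m\<close> arcs
      would correct the length from \<open>n\<close> to \<open>t\<close> modulo \<open>l\<close>,
      and \<open>m\<close> is a multiple of \<open>gamma\<close>. So some closed critical walk
      \<open>Q\<close> has length \<open>m\<close> modulo \<open>l\<close>.\<close>
    define m where "m = t + n * (l * gamma - 1)"
    have "0 < l * gamma" using l gamma_pos by simp
    then have mn: "m + n = t + n * (l * gamma)" by (cases "l * gamma") (auto simp: m_def)
    have "[m + n = 0 + n] (mod gamma)"
    proof -
      have "[t + n * (l * gamma) = n + 0] (mod gamma)"
        by (rule cong_add[OF cong_sym[OF p(5)[folded n_def]]]) (simp add: cong_0_iff)
      then show ?thesis unfolding mn by simp
    qed
    then have "gamma dvd m" by (simp only: cong_add_rcancel_nat cong_0_iff)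
    then obtain Q where Q: "walk k Q k" "set Q \<subseteq> critical_arcs" "[length Q = m] (mod l)"
      using critical_residue[OF p(3) l Z(3,5) lZ'] by blast
    define ok where "ok V \<longleftrightarrow> walk i V j \<and> set V \<subseteq> edges A \<and> visited i V \<inter> snd ` set Z \<noteq> {} \<and>
      [length V = t] (mod l) \<and> wt (p1 @ p2) \<le> wt V" for V
    have "ok (p1 @ Q @ p2)" unfolding ok_def
    proof (intro conjI)
      show "walk i (p1 @ Q @ p2) j" using p Q walk_appendI by metis
      show "set (p1 @ Q @ p2) \<subseteq> edges A" using p(4) Q(2) critical_arcs_subset by auto
      have "k \<in> visited i (p1 @ Q @ p2)" using visited_nodes[OF p(1)] by (auto simp: visited_def)
      then show "visited i (p1 @ Q @ p2) \<inter> snd ` set Z \<noteq> {}" using Z(2) by blast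
      have "[n + length Q = n + m] (mod l)" using Q(3) by (intro cong_add) auto
      also have "[n + m = t + 0] (mod l)" unfolding add.commute[of n m] mn
        by (intro cong_add) (auto simp: cong_0_iff)
      finally show "[length (p1 @ Q @ p2) = t] (mod l)" by (simp add: n_def ac_simps)
      show "wt (p1 @ p2) \<le> wt (p1 @ Q @ p2)" using critical_closed_wt[OF Q(1,2)] by simp
    qed
    then obtain V where V: "ok V" and least: "\<And>U. ok U \<Longrightarrow> length V \<le> length U"
      using ex_has_least_nat[of ok _ length] by blast
    then have V': "walk i V j" "set V \<subseteq> edges A" "visited i V \<inter> snd ` set Z \<noteq> {}"
      "[length V = t] (mod l)" "wt (p1 @ p2) \<le> wt V" by (auto simp: ok_def)
    have "length V < T + l"
    proof (rule ccontr)
      assume "\<not> length V < T + l"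
      then obtain U where U: "walk i U j" "set U \<subseteq> edges A" "visited i U \<inter> snd ` set Z \<noteq> {}"
        "[length U = length V] (mod l)" "length U < length V" "wt V \<le> wt U"
        using T(1) Z(1) V' unfolding shortens_def shortenable_def l_def by (meson not_le_imp_less)
      then have "ok U" using V' unfolding ok_def by (meson cong_trans order_trans)
      then show False using least[of U] U(5) by simp
    qed
    then have "length V < t + l" using T(2) by simp
    have le: "length V \<le> t"
    proof (rule ccontr)
      assume gt: "\<not> length V \<le> t"
      then have "l dvd length V - t" using V'(4) by (simp add: cong_altdef_nat)
      then have "l \<le> length V - t" using gt by (intro dvd_imp_le) auto
      then show False using gt \<open>length V < t + l\<close> by simp
    qed
    then obtain r where r: "t = length V + r * l"
      using V'(4) by (metis cong_altdef_nat cong_sym_eq dvd_div_mult_self le_add_diff_inverse)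
    obtain x where x: "x \<in> insert i (snd ` set V)" "x \<in> snd ` set Z" using V'(3) by (auto simp: visited_def)
    obtain X where X: "walk x X x" "mset X = mset Z"
      using is_cyc_rotate[of Z x] Z(1) x(2) unfolding crit_def by blast
    obtain v1 v2 where v: "V = v1 @ v2" "walk i v1 x" "walk x v2 j"
      using walk_split_node[OF V'(1) x(1)] by blast
    define U where "U = v1 @ concat (replicate r X) @ v2"
    have "length X = l" using X(2) unfolding l_def by (metis size_mset)
    then have lU: "length U = t" using r v(1) by (simp add: U_def length_concat_replicate)
    have "walk i U j" unfolding U_def using v walk_replicate[OF X(1)] walk_appendI by metis
    moreover have "set X \<subseteq> edges A" using Z(1) X(2) unfolding crit_def by (metis set_mset_mset)
    then have "set U \<subseteq> edges A" using V'(2) v(1) set_concat_replicate[of r X] by (auto simp: U_def)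
    ultimately have "ereal (wt U + lam * real t) \<le> mp_power A t i j"
      using power_lower[of i U j] lU by simp
    moreover have "wt X = 0" using Z(1) sum_list_mset_eq[OF X(2), of nw] by (simp add: crit_def)
    then have "wt U = wt V" using v(1) by (simp add: U_def sum_list_concat_replicate)
    then have "ereal (wt (p1 @ p2) + lam * real t) \<le> ereal (wt U + lam * real t)"
      using V'(5) by simp
    ultimately have "ereal (wt (p1 @ p2) + lam * real t) \<le> mp_power A t i j" by order
    then show "ereal (wt (p1 @ p2)) \<le> mp_power A t i j - ereal (real t * lam)"
      by (cases "mp_power A t i j") (auto simp: algebra_simps)
  qed
  then show ?thesis
    by (cases "mp_power A t i j"; cases "csr A t i j") (auto simp: lam algebra_simps)
qed

text \<open>In the second alternative of the disjunction the length that is missing after inserting \<open>C\<close>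
  can be made up by repeating a critical loop.\<close>

definition exchangeable :: "('n \<times> 'n) list \<Rightarrow> 'n \<Rightarrow> ('n \<times> 'n) list \<Rightarrow> 'n \<Rightarrow> bool" where
  "exchangeable C i W j \<longleftrightarrow> (\<exists>k p1 p2 zs. k \<in> snd ` set C \<and> walk i p1 k \<and> walk k p2 j \<and> zs \<noteq> [] \<and> (\<forall>z\<in>set zs. is_cyc z) \<and>
      mset W = mset (p1 @ p2 @ concat zs) \<and>
      (length C dvd length (concat zs) \<or>
        length C \<le> length (concat zs) \<and> (\<exists>u\<in>snd ` set C. (u, u) \<in> critical_arcs)))"

text \<open>Walks through a critical node are already covered by the CSR term. For the others, the
  missing node limits paths inside the walk to \<open>n - 2\<close> arcs.\<close>

definition exchanges :: "nat \<Rightarrow> bool" where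
  "exchanges T \<longleftrightarrow> (\<forall>C i W j. mp_cycle A C \<longrightarrow> walk i W j \<longrightarrow> set W \<subseteq> edges A \<longrightarrow>
    visited i W \<inter> snd ` set C \<noteq> {} \<longrightarrow> visited i W \<inter> critical_nodes = {} \<longrightarrow> T \<le> length W \<longrightarrow>
    exchangeable C i W j)"

section \<open>The upper inequality: heaviest walks are led to a critical node\<close>

lemma max_plus_B: "max_plus_matrix (B_CT A)"
  using max_plus by (auto simp: max_plus_matrix_def B_CT_def)

lemma power_B_le: "mp_power (B_CT A) t i j \<le> mp_power A t i j"
proof (cases "mp_power (B_CT A) t i j = -\<infinity>")
  case False
  then obtain W where W: "walk i W j" "set W \<subseteq> edges (B_CT A)" "length W = t"
    "mp_power (B_CT A) t i j = ereal (sum_list (map (entry (B_CT A)) W))"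
    using mp_power_walk[OF max_plus_B] by metis
  have e: "e \<in> edges A \<and> entry (B_CT A) e = entry A e" if "e \<in> edges (B_CT A)" for e
    using that by (auto simp: edges_def entry_def B_CT_def split: if_splits)
  then have eq: "map (entry (B_CT A)) W = map (entry A) W" and sub: "set W \<subseteq> edges A" using W(2) by auto
  show ?thesis using mp_power_ge_walk[OF max_plus W(1) sub] by (simp only: W(3,4) eq)
qed simp

lemma power_le:
  assumes T: "exchanges T" "T \<le> t"
  shows "mp_power A t i j \<le> max (ereal (real t) * max_cycle_mean A + csr A t i j) (mp_power (B_CT A) t i j)"
proof (rule ccontr)
  assume "\<not> ?thesis"
  then have above_csr: "ereal (real t) * max_cycle_mean A + csr A t i j < mp_power A t i j"
    and above_B: "mp_power (B_CT A) t i j < mp_power A t i j"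
    by (simp_all add: le_max_iff_disj not_le)
  from above_B have "mp_power A t i j \<noteq> -\<infinity>" by auto
  then obtain W0 where W0: "walk i W0 j" "set W0 \<subseteq> edges A" "length W0 = t"
    "mp_power A t i j = ereal (sum_list (map (entry A) W0))"
    using mp_power_walk[OF max_plus] by blast
  have P: "mp_power A t i j = ereal (wt W0 + lam * real t)" using W0(3,4) by (simp add: wt_eq)
  \<comment> \<open>Since \<open>W0\<close> attains the power entry, these are exactly the heaviest
    walks of length \<open>t\<close> from \<open>i\<close> to \<open>j\<close>.\<close>
  define M where "M = {W. walk i W j \<and> set W \<subseteq> edges A \<and> length W = t \<and> wt W0 \<le> wt W}"
  have M_le: "wt W \<le> wt W0" if "walk i W j" "set W \<subseteq> edges A" "length W = t" for W
    using power_lower[OF that(1,2)] that(3) P by simp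
  have "W0 \<in> M" using W0 by (simp add: M_def)
  have no_crit: "visited i W \<inter> critical_nodes = {}" if W: "W \<in> M" for W
  proof (rule ccontr)
    assume "\<not> ?thesis"
    then obtain k where k: "k \<in> insert i (snd ` set W)" "k \<in> critical_nodes" by (auto simp: visited_def)
    have W': "walk i W j" "set W \<subseteq> edges A" "length W = t" "wt W0 \<le> wt W" using W by (auto simp: M_def)
    obtain p1 p2 where p: "W = p1 @ p2" "walk i p1 k" "walk k p2 j"
      using walk_split_node[OF W'(1) k(1)] by blast
    have "ereal (wt W) \<le> csr A t i j"
      using csr_ge[OF p(2,3) k(2), of t] W' p(1) by simp
    then have "ereal (real t * lam) + ereal (wt W0) \<le> ereal (real t) * max_cycle_mean A + csr A t i j"
      using W'(4) by (intro add_mono) (auto simp: lam intro: order_trans[of _ "ereal (wt W)"])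
    then show False using above_csr P by (simp add: algebra_simps)
  qed
  obtain v where v: "v \<in> visited i W0" "v \<in> verts (G_ct A)"
  proof -
    have False if none: "visited i W0 \<inter> verts (G_ct A) = {}"
    proof -
      have e: "e \<in> edges (B_CT A) \<and> entry (B_CT A) e = entry A e" if "e \<in> set W0" for e
      proof -
        have "fst e \<notin> verts (G_ct A)" "snd e \<notin> verts (G_ct A)"
          using visited_nodes[OF W0(1)] none that by auto
        then show ?thesis using W0(2) that by (auto simp: edges_def entry_def B_CT_def)
      qed
      then have eq: "map (entry (B_CT A)) W0 = map (entry A) W0" and sub: "set W0 \<subseteq> edges (B_CT A)"
        by auto
      have "mp_power A t i j \<le> mp_power (B_CT A) t i j"
        using mp_power_ge_walk[OF max_plus_B W0(1) sub] by (simp only: W0(3,4) eq)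
      then show False using above_B by simp
    qed
    then show thesis using that by blast
  qed
  obtain \<mu>0 where \<mu>0: "linked \<mu>0 v"
    "\<And>Z x. mp_cycle A Z \<Longrightarrow> \<mu>0 < mean A Z \<Longrightarrow> x \<in> snd ` set Z \<Longrightarrow> linked (mean A Z) x"
    using G_ct_linked[OF v(2)] by blast
  \<comment> \<open>Candidates are restricted to \<open>\<mu>0\<close> and cycle means to make
    \<open>S\<close> finite; \<open>\<mu>0\<close> itself keeps it nonempty.\<close>
  define S where "S = {\<mu> \<in> insert \<mu>0 {mean A Z | Z. mp_cycle A Z}.
    \<mu>0 \<le> \<mu> \<and> (\<exists>W\<in>M. \<exists>x\<in>visited i W. linked \<mu> x)}"
  have finS: "finite S" unfolding S_def using finite_means[of A] by simp
  have "\<mu>0 \<in> S" using \<open>W0 \<in> M\<close> v(1) \<mu>0(1) by (auto simp: S_def)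
  define \<mu> where "\<mu> = Max S"
  have "\<mu> \<in> S" unfolding \<mu>_def using finS \<open>\<mu>0 \<in> S\<close> by (intro Max_in) auto
  then obtain W1 x1 where start: "W1 \<in> M" "x1 \<in> visited i W1" "linked \<mu> x1" "\<mu>0 \<le> \<mu>"
    by (auto simp: S_def)
  \<comment> \<open>A cycle of larger mean would be linked at its own mean, contradicting the
    maximality of \<open>\<mu>\<close>.\<close>
  have mean_le: "mean A z \<le> \<mu>" if W: "W \<in> M" and z: "is_cyc z" "set z \<subseteq> set W" for W z
  proof (rule ccontr)
    assume "\<not> ?thesis"
    then have gt: "\<mu> < mean A z" by simp
    have W': "walk i W j" "set W \<subseteq> edges A" using W by (auto simp: M_def)
    have mz: "mp_cycle A z" using z W' by (auto simp: mp_cycle_iff)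
    have "z \<noteq> []" using z(1) by (simp add: is_cyc_def)
    then obtain e where e: "e \<in> set z" by (meson last_in_set)
    have "linked (mean A z) (snd e)" using \<mu>0(2)[OF mz] gt start(4) e by auto
    moreover have "snd e \<in> visited i W" using e z(2) by (auto simp: visited_def)
    ultimately have "mean A z \<in> S" using mz W gt start(4) by (auto simp: S_def)
    then have "mean A z \<le> \<mu>" unfolding \<mu>_def using finS by (intro Max_ge)
    then show False using gt by simp
  qed
  have advance: "\<exists>W'\<in>M. y' \<in> visited i W'" if W: "W \<in> M" "y \<in> visited i W" and L: "(y, y') \<in> linked_arcs \<mu>" for W y y'
  proof -
    obtain C where C: "mp_cycle A C" "\<mu> \<le> mean A C" "y \<in> snd ` set C" "y' \<in> snd ` set C"
      using L unfolding linked_arcs_def by blast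
    have W': "walk i W j" "set W \<subseteq> edges A" "length W = t" "wt W0 \<le> wt W" using W(1) by (auto simp: M_def)
    have "visited i W \<inter> snd ` set C \<noteq> {}" using C(3) W(2) by blast
    then obtain k p1 p2 zs where ex: "k \<in> snd ` set C" "walk i p1 k" "walk k p2 j" "zs \<noteq> []" "\<forall>z\<in>set zs. is_cyc z"
      and ms: "mset W = mset (p1 @ p2 @ concat zs)"
      and alt: "length C dvd length (concat zs) \<or>
        length C \<le> length (concat zs) \<and> (\<exists>u\<in>snd ` set C. (u, u) \<in> critical_arcs)"
      using T C(1) W'(1-3) no_crit[OF W(1)] unfolding exchanges_def exchangeable_def by metis
    have sW: "set W = set (p1 @ p2 @ concat zs)" using ms by (metis set_mset_mset)
    have lW: "t = length p1 + length p2 + length (concat zs)"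
      using arg_cong[OF ms, of size] W'(3) by simp
    have wW: "wt W = wt p1 + wt p2 + wt (concat zs)" using sum_list_mset_eq[OF ms, of nw] by simp
    have zs_wt: "wt (concat zs) \<le> (\<mu> - lam) * real (length (concat zs))"
    proof (rule weight_concat_le)
      fix z assume z: "z \<in> set zs"
      then have "is_cyc z" "set z \<subseteq> set W" using ex(5) sW by auto
      then have "mean A z \<le> \<mu>" "z \<noteq> []" using mean_le[OF W(1)] by (auto simp: is_cyc_def)
      then show "wt z \<le> (\<mu> - lam) * real (length z)" using wt_eq_mean[of z] by (simp add: mult_right_mono)
    qed
    have C': "is_cyc C" "set C \<subseteq> edges A" "C \<noteq> []" using C(1) by (auto simp: mp_cycle_iff is_cyc_def)
    then obtain X where X: "walk k X k" "mset X = mset C" using is_cyc_rotate[of C k] ex(1) by blast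
    have X': "set X = set C" "length X = length C" "wt X = (mean A C - lam) * real (length C)"
      using X(2) sum_list_mset_eq[OF X(2), of nw] wt_eq_mean[OF C'(3)] by (metis set_mset_mset, metis size_mset, simp)
    have "zs ! 0 \<in> set zs" "zs ! 0 \<noteq> []" using ex(4,5) by (auto simp: is_cyc_def)
    then have pos: "0 < length (concat zs)" by (auto simp: length_pos_if_in_set)
    show ?thesis using alt
    proof
      assume "length C dvd length (concat zs)"
      then obtain r where r: "length (concat zs) = r * length C" by (metis dvd_def mult.commute)
      define V where "V = p1 @ concat (replicate r X) @ p2"
      have "walk i V j" unfolding V_def using ex(2,3) walk_replicate[OF X(1)] walk_appendI by metis
      moreover have "set V \<subseteq> edges A"
        using W'(2) sW C'(2) X'(1) set_concat_replicate[of r X] by (auto simp: V_def)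
      moreover have "length V = t" using lW r X'(2) by (simp add: V_def length_concat_replicate)
      moreover have "wt W \<le> wt V"
      proof -
        have "(\<mu> - lam) * real (length (concat zs)) \<le> (mean A C - lam) * real (length (concat zs))"
          using C(2) by (intro mult_right_mono) auto
        also have "\<dots> = real r * wt X" by (simp add: r X'(3))
        finally have "wt (concat zs) \<le> real r * wt X" using zs_wt by linarith
        then show ?thesis using wW by (simp add: V_def sum_list_concat_replicate)
      qed
      ultimately have "V \<in> M" using W'(4) by (auto simp: M_def)
      moreover have "r \<noteq> 0" using r pos by auto
      then have "set X \<subseteq> set V" by (cases r) (auto simp: V_def)
      then have "y' \<in> visited i V" using C(4) X'(1) by (auto simp: visited_def)
      ultimately show ?thesis by blast
    next
      assume "length C \<le> length (concat zs) \<and> (\<exists>u\<in>snd ` set C. (u, u) \<in> critical_arcs)"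
      then obtain u where u: "u \<in> snd ` set C" "(u, u) \<in> critical_arcs" and le: "length C \<le> length (concat zs)"
        by blast
      define V where "V = p1 @ X @ p2"
      have wV: "walk i V j" unfolding V_def using ex(2,3) X(1) walk_appendI by metis
      have "u \<in> insert i (snd ` set V)" using u(1) X'(1) by (auto simp: V_def)
      then obtain v1 v2 where vv: "V = v1 @ v2" "walk i v1 u" "walk u v2 j"
        using walk_split_node[OF wV] by blast
      define m where "m = length (concat zs) - length C"
      define U where "U = v1 @ concat (replicate m [(u, u)]) @ v2"
      have loop: "walk u [(u, u)] u" by simp
      have "walk i U j" unfolding U_def using vv walk_replicate[OF loop, of m] walk_appendI by metis
      moreover have "set U \<subseteq> edges A"
      proof -
        have "set V \<subseteq> edges A" using W'(2) sW C'(2) X'(1) by (auto simp: V_def)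
        moreover have "(u, u) \<in> edges A" using u(2) critical_arcs_subset by blast
        ultimately show ?thesis using vv(1) set_concat_replicate[of m "[(u, u)]"] by (auto simp: U_def)
      qed
      moreover have "length U = t"
      proof -
        have "length U = length V + m" using vv(1) by (simp add: U_def length_concat_replicate)
        then show ?thesis using lW le X'(2) by (simp add: V_def m_def)
      qed
      \<comment> \<open>In normalised weight the removed cycles lose at least
        \<open>lam - \<mu>\<close> per arc, \<open>C\<close> loses at most that per arc on no more
        arcs, and the loops lose nothing.\<close>
      moreover have "wt W \<le> wt U"
      proof -
        have "wt [(u, u)] = 0" using critical_closed_wt[OF loop] u(2) by simp
        then have UV: "wt U = wt V" using vv(1) by (simp add: U_def sum_list_concat_replicate sum_list_replicate)
        have "mean A C \<le> lam" using mean_le_lam[OF C(1)] .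
        then have "(\<mu> - lam) * real (length (concat zs)) \<le> (\<mu> - lam) * real (length C)"
          using C(2) le by (intro mult_left_mono_neg) auto
        also have "\<dots> \<le> wt X" unfolding X'(3) using C(2) by (intro mult_right_mono) auto
        finally have "wt (concat zs) \<le> wt X" using zs_wt by linarith
        then show ?thesis using wW UV by (simp add: V_def)
      qed
      ultimately have "U \<in> M" using W'(4) by (auto simp: M_def)
      moreover have "u \<in> visited i U" using visited_nodes[OF vv(2)] by (auto simp: visited_def U_def)
      moreover have "u \<in> critical_nodes" using critical_arc_nodes[OF u(2)] by simp
      ultimately show ?thesis using no_crit by blast
    qed
  qed
  obtain c where c: "c \<in> critical_nodes" "(x1, c) \<in> (linked_arcs \<mu>)\<^sup>*" using start(3) by (auto simp: linked_def)
  from c(2) have "\<exists>W\<in>M. c \<in> visited i W"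
  proof (induction rule: rtrancl_induct)
    case base
    then show ?case using start by blast
  next
    case (step y z)
    then show ?case using advance by blast
  qed
  then show False using no_crit c(1) by blast
qed

lemma T1_le:
  assumes "shortens T" "exchanges T"
  shows "T1 A (B_CT A) \<le> enat T"
proof -
  have "mp_power A t = mp_add (mp_scale (ereal (real t) * max_cycle_mean A) (csr A t)) (mp_power (B_CT A) t)"
    if "T \<le> t" for t
    unfolding mp_add_def mp_scale_def
    using power_le[OF assms(2) that] csr_le_power[OF assms(1) that] power_B_le
    by (intro ext antisym) auto
  then show ?thesis unfolding T1_def by (intro Inf_lower) auto
qed

section \<open>Length conditions behind the three bounds\<close>

lemma shortening:
  assumes Z: "crit Z" and W: "walk i W j" "set W \<subseteq> edges A" and touch: "visited i W \<inter> snd ` set Z \<noteq> {}"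
    and q: "\<And>x r y. walk x r y \<Longrightarrow> distinct (x # map snd r) \<Longrightarrow> set r \<subseteq> set W \<Longrightarrow> length r \<le> q"
    and long: "(length Z - 1) * (q + 1) + min (CARD('n) - length Z) q + q < length W"
  shows "shortenable Z i W j"
proof -
  have cyc: "is_cyc Z" using Z by (simp add: crit_def)
  obtain p1 p2 zs k where ex: "k \<in> snd ` set Z" "walk i p1 k" "walk k p2 j" "zs \<noteq> []"
    "\<forall>z\<in>set zs. is_cyc z" "length Z dvd length (concat zs)" and ms: "mset W = mset (p1 @ p2 @ concat zs)"
    by (rule touching_cycle_exchange[OF cyc W(1) touch _ long]) (use q in blast)+
  have sW: "set W = set (p1 @ p2 @ concat zs)" using ms by (metis set_mset_mset)
  have lW: "length W = length (p1 @ p2) + length (concat zs)" using arg_cong[OF ms, of size] by simp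
  have "sum_list (map nw (concat zs)) \<le> 0 * real (length (concat zs))"
  proof (rule weight_concat_le)
    fix z assume "z \<in> set zs"
    then have "is_cyc z" "set z \<subseteq> edges A" using ex(5) sW W(2) by auto
    then show "wt z \<le> 0 * real (length z)" using cycle_wt_le_0 by simp
  qed
  then have "wt W \<le> wt (p1 @ p2)" using sum_list_mset_eq[OF ms, of nw] by simp
  moreover have "zs ! 0 \<in> set zs" "zs ! 0 \<noteq> []" using ex(4,5) by (auto simp: is_cyc_def)
  then have "0 < length (concat zs)" by (auto simp: length_pos_if_in_set)
  moreover have "[length (p1 @ p2) + 0 = length (p1 @ p2) + length (concat zs)] (mod length Z)"
    using ex(6) by (intro cong_add) (auto simp: cong_0_iff cong_sym_eq[of 0])
  moreover have "k \<in> visited i (p1 @ p2)" using visited_nodes[OF ex(2)] by (auto simp: visited_def)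
  moreover have "set (p1 @ p2) \<subseteq> edges A" using sW W(2) by auto
  ultimately show ?thesis unfolding shortenable_def using walk_appendI[OF ex(2,3)] ex(1) lW
    by (intro exI[of _ "p1 @ p2"]) auto
qed

lemma cycle_length_bounds:
  assumes "mp_cycle A C"
  shows "0 < length C" "length C \<le> cr (mp_digraph A)" "length C \<le> CARD('n)"
  using assms cycle_length_le_cr[of C A] is_cyc_length[of C] by (auto simp: mp_cycle_iff is_cyc_def)

lemma crit_length:
  assumes "crit Z"
  shows "0 < length Z" "length Z \<le> cr (mp_digraph A)" "length Z \<le> CARD('n)"
  using assms cycle_length_bounds[of Z] crit_iff by blast+

lemma cd_less_card: "cd (mp_digraph A) < CARD('n)"
proof -
  let ?S = "{length W | W. \<exists>u v. pre_digraph.apath (mp_digraph A) u W v}"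
  have less: "x < CARD('n)" if x: "x \<in> ?S" for x
  proof -
    obtain u :: 'n and W :: "('n \<times> 'n) list" where "x = length W" "distinct (u # map snd W)" using x unfolding apath_mp_digraph by blast
    then have "x \<le> CARD('n) - 1" using path_length[of u W] by blast
    moreover have "0 < CARD('n)" by simp
    ultimately show ?thesis by linarith
  qed
  then have fin: "finite ?S" by (intro finite_subset[of ?S "{..<CARD('n)}"]) auto
  have "pre_digraph.apath (mp_digraph A) (undefined :: 'n) [] undefined" by (simp add: apath_mp_digraph)
  then have "?S \<noteq> {}" by blast
  then have "cd (mp_digraph A) \<in> ?S" unfolding cd_def using fin by (intro Max_in)
  then show ?thesis by (rule less)
qed

lemma path_le_cd:
  "walk x r y \<Longrightarrow> distinct (x # map snd r) \<Longrightarrow> set r \<subseteq> set W \<Longrightarrow> set W \<subseteq> edges A \<Longrightarrow>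
    length r \<le> cd (mp_digraph A)"
  by (rule path_length_le_cd) auto

lemma shortens_if_cd:
  assumes "\<And>c. 0 < c \<Longrightarrow> c \<le> cr (mp_digraph A) \<Longrightarrow> c \<le> CARD('n) \<Longrightarrow>
    (c - 1) * (cd (mp_digraph A) + 1) + 2 * cd (mp_digraph A) < T + c"
  shows "shortens T"
  unfolding shortens_def
proof (intro allI impI)
  fix Z i W j
  assume Z: "crit Z" and W: "walk i W j" "set W \<subseteq> edges A" "visited i W \<inter> snd ` set Z \<noteq> {}"
    "T + length Z \<le> length W"
  show "shortenable Z i W j"
    by (rule shortening[OF Z W(1-3), of "cd (mp_digraph A)"])
      (use path_le_cd W(2) in blast, use assms[OF crit_length[OF Z]] W(4) in linarith)
qed

text \<open>Put \<open>N = n - 1\<close> and \<open>length Z = c' + 1\<close>. For a non-Hamiltonian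
  \<open>Z\<close> the walk can be cut once it has more than
  \<open>c' * (N + 1) + (N - c') + N = c' * N + 2 * N\<close> arcs. This is below
  \<open>N\<^sup>2 + 1 + length Z\<close>, by just 1 when \<open>length Z = N\<close>.\<close>

lemma shortens_Wi: "shortens (Wi CARD('n))"
  unfolding shortens_def
proof (intro allI impI)
  fix Z i W j
  assume Z: "crit Z" and W: "walk i W j" "set W \<subseteq> edges A" "visited i W \<inter> snd ` set Z \<noteq> {}"
    "Wi CARD('n) + length Z \<le> length W"
  show "shortenable Z i W j"
  proof (cases "length Z = CARD('n)")
    case True
    have Z': "is_cyc Z" "wt Z = 0" "set Z \<subseteq> edges A" using Z by (auto simp: crit_def)
    obtain V where "walk i V j" "set V \<subseteq> edges A" "[length V = length W] (mod CARD('n))"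
      "length V < Wi CARD('n) + CARD('n)" "wt W \<le> wt V"
      using hamiltonian_shortening[OF Z'(1) True Z'(2,3) W(1,2)] cycle_wt_le_0 by metis
    moreover have "snd ` set Z = UNIV"
      using card_cycle_nodes[OF Z'(1)] True by (simp add: card_eq_UNIV_imp_eq_UNIV)
    ultimately show ?thesis unfolding shortenable_def using True W(4) by (intro exI[of _ V]) (auto simp: visited_def)
  next
    case False
    define N where "N = CARD('n) - 1"
    obtain c' where c: "length Z = Suc c'" using crit_length(1)[OF Z] gr0_implies_Suc by blast
    have N: "CARD('n) = N + 1" by (simp add: N_def)
    have c': "c' + 1 \<le> N" using False crit_length(3)[OF Z] c N by simp
    then obtain d where d: "N = c' + 1 + d" using le_Suc_ex by blast
    show ?thesis
    proof (rule shortening[OF Z W(1-3)])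
      show "length r \<le> N" if "distinct (x # map snd r)" for x and r :: "('n \<times> 'n) list"
        using path_length[OF that] by (simp add: N_def)
      have "(length Z - 1) * (N + 1) + min (CARD('n) - length Z) N + N \<le> c' * (N + 1) + (N - c') + N"
        by (simp add: c N)
      also have "\<dots> < N\<^sup>2 + 1 + length Z" unfolding c d by (simp add: power2_eq_square algebra_simps)
      also have "\<dots> \<le> length W" using W(4) c' by (simp add: Wi_def N)
      finally show "(length Z - 1) * (N + 1) + min (CARD('n) - length Z) N + N < length W" .
    qed
  qed
qed

lemma visited_noncritical:
  assumes "visited i W \<inter> critical_nodes = {}"
  shows "card (visited i W) < CARD('n)"
proof -
  obtain Z e where "crit Z" "e \<in> set Z" using ex_crit crit_length(1) by (metis length_greater_0_conv last_in_set)
  then have "snd e \<in> critical_nodes" by (auto simp: critical_graph_simps)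
  then have "visited i W \<subset> UNIV" using assms by blast
  then show ?thesis by (intro psubset_card_mono) auto
qed

lemma exchange:
  assumes C: "mp_cycle A C" and W: "walk i W j" and touch: "visited i W \<inter> snd ` set C \<noteq> {}"
    and q: "\<And>x r y. walk x r y \<Longrightarrow> distinct (x # map snd r) \<Longrightarrow> set r \<subseteq> set W \<Longrightarrow> length r \<le> q"
    and long: "(length C - 1) * (q + 1) + min (CARD('n) - length C) q + q < length W"
  shows "exchangeable C i W j"
proof -
  have cyc: "is_cyc C" using C by (simp add: mp_cycle_iff)
  show ?thesis unfolding exchangeable_def
    by (rule touching_cycle_exchange[OF cyc W touch _ long]) (use q in blast)+
qed

text \<open>The case \<open>2 \<le> CARD('n)\<close> is enough, because the walk visits a node and
  misses a critical one.\<close>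

lemma exchanges_if_cd:
  assumes "\<And>c. 0 < c \<Longrightarrow> c \<le> cr (mp_digraph A) \<Longrightarrow> 2 \<le> CARD('n) \<Longrightarrow>
    (c - 1) * (min (CARD('n) - 2) (cd (mp_digraph A)) + 1) + 2 * min (CARD('n) - 2) (cd (mp_digraph A)) < T"
  shows "exchanges T"
  unfolding exchanges_def
proof (intro allI impI)
  fix C i W j
  assume C: "mp_cycle A C" and W: "walk i W j" "set W \<subseteq> edges A" "visited i W \<inter> snd ` set C \<noteq> {}"
    "visited i W \<inter> critical_nodes = {}" "T \<le> length W"
  let ?q = "min (CARD('n) - 2) (cd (mp_digraph A))"
  have "0 < card (visited i W)" by (simp add: visited_def card_gt_0_iff)
  then have n: "card (visited i W) - 1 \<le> CARD('n) - 2" "2 \<le> CARD('n)"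
    using visited_noncritical[OF W(4)] by linarith+
  show "exchangeable C i W j"
  proof (rule exchange[OF C W(1,3), of ?q])
    show "length r \<le> ?q" if r: "walk x r y" "distinct (x # map snd r)" "set r \<subseteq> set W" for x r y
      using visited_path_length[OF W(1) r] path_le_cd[OF r W(2)] n(1) by simp
    show "(length C - 1) * (?q + 1) + min (CARD('n) - length C) ?q + ?q < length W"
      using assms[OF cycle_length_bounds(1,2)[OF C] n(2)] W(5) by linarith
  qed
qed

text \<open>Counting suffices unless \<open>C\<close> is Hamiltonian and the walk misses only one
  node. That node is then the only critical one, so it carries a critical loop, and it is enough
  that the cycles cut out of the walk have total length at least \<open>n\<close>.\<close>

lemma exchanges_Wi: "exchanges (Wi CARD('n))"
  unfolding exchanges_def
proof (intro allI impI)
  fix C i W j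
  assume C: "mp_cycle A C" and W: "walk i W j" "set W \<subseteq> edges A" "visited i W \<inter> snd ` set C \<noteq> {}"
    "visited i W \<inter> critical_nodes = {}" "Wi CARD('n) \<le> length W"
  have pos: "0 < card (visited i W)" by (simp add: visited_def card_gt_0_iff)
  define N where "N = CARD('n) - 1"
  have N: "CARD('n) = N + 1" by (simp add: N_def)
  have less: "card (visited i W) \<le> N" using visited_noncritical[OF W(4)] N by simp
  have N1: "1 \<le> N" using less pos by linarith
  have lW: "N\<^sup>2 + 1 \<le> length W" using W(5) N1 by (simp add: Wi_def N)
  obtain c' where c: "length C = Suc c'" using cycle_length_bounds(1)[OF C] gr0_implies_Suc by blast
  have c'N: "c' \<le> N" using cycle_length_bounds(3)[OF C] c N by simp
  show "exchangeable C i W j"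
  proof (cases "c' = N")
    case False
    then have "c' + 1 \<le> N" using c'N by simp
    then obtain d where d: "N = c' + 1 + d" using le_Suc_ex by blast
    show ?thesis
    proof (rule exchange[OF C W(1,3), of "N - 1"])
      show "length r \<le> N - 1" if r: "walk x r y" "distinct (x # map snd r)" "set r \<subseteq> set W" for x r y
        using visited_path_length[OF W(1) r] less by simp
      have "(length C - 1) * (N - 1 + 1) + min (CARD('n) - length C) (N - 1) + (N - 1)
          \<le> c' * N + (N - c') + (N - 1)"
        using N1 by (simp add: c N)
      \<comment> \<open>For \<open>length C = N\<close> the left side is exactly
        \<open>N\<^sup>2\<close>.\<close>
      also have "\<dots> < N\<^sup>2 + 1" unfolding d by (simp add: power2_eq_square algebra_simps)
      finally show "(length C - 1) * (N - 1 + 1) + min (CARD('n) - length C) (N - 1) + (N - 1) < length W"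
        using lW by simp
    qed
  next
    case True
    then have len: "length C = CARD('n)" using c N by simp
    then have all: "snd ` set C = UNIV"
      using card_cycle_nodes[of C] C by (simp add: mp_cycle_iff card_eq_UNIV_imp_eq_UNIV)
    show ?thesis
    proof (cases "card (visited i W) = N")
      case False
      then have v: "card (visited i W) \<le> N - 1" and N2: "2 \<le> N" using less pos by linarith+
      \<comment> \<open>A second missed node lowers the path bound to \<open>N - 2\<close>, which
        makes up for the maximal length of \<open>C\<close>.\<close>
      then obtain m where m: "N = m + 2" using le_Suc_ex by (metis add.commute)
      show ?thesis
      proof (rule exchange[OF C W(1,3), of m])
        show "length r \<le> m" if r: "walk x r y" "distinct (x # map snd r)" "set r \<subseteq> set W" for x r y
          using visited_path_length[OF W(1) r] v m by simp
        have "(length C - 1) * (m + 1) + min (CARD('n) - length C) m + m = (m + 2) * (m + 1) + m"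
          by (simp add: len N m)
        also have "\<dots> < N\<^sup>2 + 1" unfolding m by (simp add: power2_eq_square algebra_simps)
        finally show "(length C - 1) * (m + 1) + min (CARD('n) - length C) m + m < length W"
          using lW by simp
      qed
    next
      case True
      obtain r zs where r: "walk i r j" "distinct (i # map snd r)" "\<forall>z\<in>set zs. is_cyc z"
        "mset W = mset r + mset (concat zs)" using path_decomposition[OF W(1)] by blast
      have "set r \<subseteq> set W" using r(4) by (metis set_mset_mset set_append mset_append Un_upper1)
      then have "length r \<le> N - 1" using visited_path_length[OF W(1) r(1,2)] less by simp
      moreover have "length W = length r + length (concat zs)" using arg_cong[OF r(4), of size] by simp
      moreover have "2 * N \<le> N\<^sup>2 + 1"
      proof -
        obtain d where "N = d + 1" using N1 le_Suc_ex by (metis add.commute)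
        then show ?thesis by (simp add: power2_eq_square)
      qed
      ultimately have big: "length C \<le> length (concat zs)" using lW len N N1 by linarith
      then have "zs \<noteq> []" using c by auto
      obtain Z where Z: "crit Z" using ex_crit by blast
      obtain e where e: "e \<in> set Z" using crit_length(1)[OF Z] by (metis length_greater_0_conv last_in_set)
      have ec: "e \<in> critical_arcs" using Z e by (auto simp: critical_graph_simps)
      have "card (- visited i W) = 1" using True N by (simp add: Compl_eq_Diff_UNIV card_Diff_subset)
      then obtain u where u: "- visited i W = {u}" by (meson card_1_singletonE)
      have "fst e = u" "snd e = u" using critical_arc_nodes[OF ec] W(4) u by blast+
      then have "(u, u) \<in> critical_arcs" using ec by (metis prod.collapse)
      \<comment> \<open>As \<open>C\<close> passes through every node, it can be inserted right at
        the start.\<close>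
      moreover have "walk i [] i" by simp
      ultimately show ?thesis unfolding exchangeable_def using r big \<open>zs \<noteq> []\<close> all
        by (intro exI[of _ i] exI[of _ "[]"] exI[of _ r] exI[of _ zs]) auto
    qed
  qed
qed

lemma T1_le_Wi: "T1 A (B_CT A) \<le> enat (Wi CARD('n))"
  using T1_le shortens_Wi exchanges_Wi by blast

lemma cr_pos: "0 < cr (mp_digraph A)"
  using ex_crit crit_length by (metis le_zero_eq neq0_conv)

text \<open>For exchanges the count is regrouped as \<open>c * (q + 1) + q - 1\<close>: since
  \<open>q \<le> n - 2\<close>, the product is at most \<open>(n - 1) * cr\<close>, and
  \<open>q\<close> is below the minimum. For shortening, \<open>c * cd\<close> is covered by the
  product, and the allowance \<open>c\<close> absorbs the remaining \<open>c - 1\<close>.\<close>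

lemma T1_le_cr_card:
  "T1 A (B_CT A) \<le> enat ((CARD('n) - 1) * cr (mp_digraph A)
      + min CARD('n) (cd (mp_digraph A) + cr (mp_digraph A) + 1))"
proof (rule T1_le)
  let ?r = "cr (mp_digraph A)" and ?d = "cd (mp_digraph A)"
  let ?T = "(CARD('n) - 1) * ?r + min CARD('n) (?d + ?r + 1)"
  show "shortens ?T"
  proof (rule shortens_if_cd)
    fix c assume c: "0 < c" "c \<le> ?r"
    obtain b where b: "c = Suc b" using c(1) gr0_implies_Suc by blast
    have "c * ?d \<le> ?r * (CARD('n) - 1)" using c(2) cd_less_card by (intro mult_le_mono) auto
    moreover have "(c - 1) * (?d + 1) + 2 * ?d = c * ?d + b + ?d" by (simp add: b)
    ultimately show "(c - 1) * (?d + 1) + 2 * ?d < ?T + c" using cd_less_card b by (simp add: mult.commute)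
  qed
  show "exchanges ?T"
  proof (rule exchanges_if_cd)
    let ?q = "min (CARD('n) - 2) ?d"
    fix c assume c: "0 < c" "c \<le> ?r" "2 \<le> CARD('n)"
    obtain b where b: "c = Suc b" using c(1) gr0_implies_Suc by blast
    have "c * (?q + 1) \<le> ?r * (CARD('n) - 1)" using c by (intro mult_le_mono) auto
    moreover have "(c - 1) * (?q + 1) + 2 * ?q + 1 = c * (?q + 1) + ?q" by (simp add: b)
    moreover have "?q < min CARD('n) (?d + ?r + 1)" using c(3) by auto
    ultimately show "(c - 1) * (?q + 1) + 2 * ?q < ?T" unfolding mult.commute[of _ ?r] by linarith
  qed
qed

text \<open>For exchanges, \<open>q * c + (c - 1) + q\<close> is compared term by term with
  \<open>cd * cr + (cr - 1) * cr + cd\<close>, the bound minus 1.\<close>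

lemma T1_le_cr_cd:
  "T1 A (B_CT A) \<le> enat ((cd (mp_digraph A) + cr (mp_digraph A) - 1) * cr (mp_digraph A)
      + cd (mp_digraph A) + 1)"
proof (rule T1_le)
  let ?r = "cr (mp_digraph A)" and ?d = "cd (mp_digraph A)"
  let ?T = "(?d + ?r - 1) * ?r + ?d + 1"
  obtain s where s: "?r = Suc s" using cr_pos gr0_implies_Suc by blast
  have T: "?T = ?d * ?r + s * ?r + ?d + 1" unfolding s by (simp add: algebra_simps)
  show "shortens ?T"
  proof (rule shortens_if_cd)
    fix c assume c: "0 < c" "c \<le> ?r"
    obtain b where b: "c = Suc b" using c(1) gr0_implies_Suc by blast
    have "c * ?d \<le> ?d * ?r" using c(2) by simp
    moreover have "(c - 1) * (?d + 1) + 2 * ?d = c * ?d + b + ?d" by (simp add: b)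
    ultimately show "(c - 1) * (?d + 1) + 2 * ?d < ?T + c" unfolding T using b by linarith
  qed
  show "exchanges ?T"
  proof (rule exchanges_if_cd)
    let ?q = "min (CARD('n) - 2) ?d"
    fix c assume c: "0 < c" "c \<le> ?r"
    obtain b where b: "c = Suc b" using c(1) gr0_implies_Suc by blast
    have "?q * c \<le> ?d * ?r" using c(2) by (intro mult_le_mono) auto
    moreover have "(c - 1) * (?q + 1) + 2 * ?q = ?q * c + b + ?q" by (simp add: b)
    moreover have "b \<le> s * ?r" using c(2) b s by (simp add: trans_le_add1)
    moreover have "?q \<le> ?d" by simp
    ultimately show "(c - 1) * (?q + 1) + 2 * ?q < ?T" unfolding T by linarith
  qed
qed

end

theorem theorem4p4:
  fixes A :: "'n::finite mp_matrix"
  assumes "max_plus_matrix A"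
    and "max_cycle_mean A \<noteq> -\<infinity>"
  shows "T1 A (B_CT A) \<le> enat (Wi CARD('n)) \<and>
    T1 A (B_CT A) \<le> enat ((CARD('n) - 1) * cr (mp_digraph A)
        + min CARD('n) (cd (mp_digraph A) + cr (mp_digraph A) + 1)) \<and>
    T1 A (B_CT A) \<le> enat ((cd (mp_digraph A) + cr (mp_digraph A) - 1) * cr (mp_digraph A)
        + cd (mp_digraph A) + 1)"
proof -
  obtain l where "max_cycle_mean A = ereal l"
    using max_cycle_mean_real[OF assms(2)] by metis
  then interpret max_plus_setting A l using assms(1) by unfold_locales
  show ?thesis using T1_le_Wi T1_le_cr_card T1_le_cr_cd by blast
qed

end
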